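(* Let $V$ be a superspace of dimension $n|m$ and $1\le r\le n$. On the projective superspace $P^{\mathrm{ess}}(\Lambda^r(V))$ with homogeneous coordinates $u^{a_1\dots a_r}$ (even) and $u^{a_1\dots a_{r-1}\hat\mu}$ (odd), the super Plücker relations, i.e. the relations specifying the image of the super Plücker map $G_r(V)\to P^{\mathrm{ess}}(\Lambda^r(V))$, take the form $$u^{a_1\ldots a_r}u^{b_1\ldots b_r}=\sum_{j=1}^{r}u^{b_ja_2\ldots a_r}\,u^{b_1\ldots b_{j-1}a_1b_{j+1}\ldots b_r}\qquad\text{(even)}$$ for all $a_1,\dots,a_r,b_1,\dots,b_r\in\{1,\dots,n\}$, and $$u^{a_1\ldots a_r}u^{b_1\ldots b_{r-1}\hat\mu}=\sum_{j=1}^{r-1}u^{b_ja_2\ldots a_r}\,u^{b_1\ldots b_{j-1}a_1b_{j+1}\ldots b_{r-1}\hat\mu}+u^{\hat\mu a_2\ldots a_r}\,u^{b_1\ldots b_{r-1}a_1}\qquad\text{(odd)}$$ for all $a_1,\dots,a_r,b_1,\dots,b_{r-1}\in\{1,\dots,n\}$ and all $\mu\in\{1,\dots,m\}$.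
   Context: All objects are taken over arbitrary commutative superalgebras (functor-of-points sense). $G_r(V)=G_{r|0}(V)$ is the super Grassmannian of $r|0$-planes: the quotient by the left action of $\mathrm{GL}(r)$ of the supermanifold of $r\times(n|m)$ matrices $U=(u_i{}^a\,|\,u_i{}^{\hat\mu})$, $i=1,\dots,r$, $a=1,\dots,n$, $\mu=1,\dots,m$ ($u_i{}^a$ even, $u_i{}^{\hat\mu}$ odd) containing an invertible $r\times r$ submatrix of even columns. Write $U^a$, $U^{\hat\mu}$ for the columns of $U$. $P^{\mathrm{ess}}(\Lambda^r(V))$ is the projective superspace with homogeneous coordinates $u^{a_1\dots a_r}$ (even, $a_1<\dots<a_r$) and $u^{a_1\dots a_{r-1}\hat\mu}$ (odd, $a_1<\dots<a_{r-1}$), i.e. at least one even coordinate is invertible and all coordinates are taken up to a common even invertible factor. The notation is extended to arbitrary index combinations, and to an arbitrary position of the index $\hat\mu$, by (ordinary) antisymmetry in all indices. The super Plücker map $G_r(V)\to P^{\mathrm{ess}}(\Lambda^r(V))$ is $$u^{a_1\dots a_r}=\det(U^{a_1},\dots,U^{a_r}),\qquad u^{a_1\dots a_{r-1}\hat\mu}=\det(U^{a_1},\dots,U^{a_{r-1}},U^{\hat\mu}),$$ the determinant in the second formula being well defined by multilinearity since only one column is odd. *)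

theory Defs
  imports "Jordan_Normal_Form.Determinant" "HOL-Library.FuncSet"
begin

text \<open>
  Commutative superalgebras over a field \<open>k\<close>: associative unital \<open>k\<close>-algebras with a
  \<open>\<int>/2\<close>-grading by subspaces \<open>A0\<close> (even) and \<open>A1\<close> (odd), subject to the sign rule
  \<open>x y = (-1)\<^bsup>|x||y|\<^esup> y x\<close> for homogeneous \<open>x\<close>, \<open>y\<close>.
  In characteristic 2 the squares of odd elements are thus not required to vanish.
\<close>

locale comm_superalgebra = vector_space scale
  for scale :: "'k::field \<Rightarrow> 'a::ring_1 \<Rightarrow> 'a" +
  fixes A0 A1 :: "'a set"
  assumes scale_mult_left: "scale c x * y = scale c (x * y)"
    and scale_mult_right: "x * scale c y = scale c (x * y)"
    and subspace_even: "subspace A0"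
    and subspace_odd: "subspace A1"
    and even_Int_odd: "A0 \<inter> A1 = {0}"
    and even_plus_odd: "\<exists>y\<in>A0. \<exists>z\<in>A1. x = y + z"
    and one_even: "1 \<in> A0"
    and even_even: "\<lbrakk>x \<in> A0; y \<in> A0\<rbrakk> \<Longrightarrow> x * y \<in> A0"
    and even_odd: "\<lbrakk>x \<in> A0; y \<in> A1\<rbrakk> \<Longrightarrow> x * y \<in> A1"
    and odd_even: "\<lbrakk>x \<in> A1; y \<in> A0\<rbrakk> \<Longrightarrow> x * y \<in> A1"
    and odd_odd: "\<lbrakk>x \<in> A1; y \<in> A1\<rbrakk> \<Longrightarrow> x * y \<in> A0"
    and commute_even_even: "\<lbrakk>x \<in> A0; y \<in> A0\<rbrakk> \<Longrightarrow> x * y = y * x"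
    and commute_even_odd: "\<lbrakk>x \<in> A0; y \<in> A1\<rbrakk> \<Longrightarrow> x * y = y * x"
    and anticommute_odd_odd: "\<lbrakk>x \<in> A1; y \<in> A1\<rbrakk> \<Longrightarrow> x * y = - (y * x)"

definition invertible_elem :: "'a::ring_1 \<Rightarrow> bool" where
  "invertible_elem x \<longleftrightarrow> (\<exists>y. x * y = 1 \<and> y * x = 1)"

text \<open>
  All indices are counted from 0. The even index \<open>a\<close> is the number \<open>a < n\<close>, the odd index
  \<open>\<mu>\<close> (with \<open>\<mu> < m\<close>) is the number \<open>n + \<mu>\<close>, and a multi-index is a list of such numbers.
\<close>

definition even_idx :: "nat \<Rightarrow> nat \<Rightarrow> nat list set" where
  "even_idx n r = {as. length as = r \<and> set as \<subseteq> {..<n} \<and> sorted_wrt (<) as}"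

definition odd_idx :: "nat \<Rightarrow> nat \<Rightarrow> nat \<Rightarrow> nat list set" where
  "odd_idx n m r = {as @ [n + \<mu>] |as \<mu>. as \<in> even_idx n (r - 1) \<and> \<mu> < m}"

definition ess_idx :: "nat \<Rightarrow> nat \<Rightarrow> nat \<Rightarrow> nat list set" where
  "ess_idx n m r = even_idx n r \<union> odd_idx n m r"

text \<open>
  Homogeneous coordinates of the points of \<open>P\<^sup>e\<^sup>s\<^sup>s(\<Lambda>\<^sup>r V)\<close>. They are functions on the
  increasing multi-indices only (with the value \<open>undefined\<close> elsewhere).
\<close>

definition ess_coords ::
  "'a::ring_1 set \<Rightarrow> 'a set \<Rightarrow> nat \<Rightarrow> nat \<Rightarrow> nat \<Rightarrow> (nat list \<Rightarrow> 'a) set" where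
  "ess_coords A0 A1 n m r =
    {u \<in> extensional (ess_idx n m r).
      (\<forall>I\<in>even_idx n r. u I \<in> A0) \<and> (\<forall>I\<in>odd_idx n m r. u I \<in> A1) \<and>
      (\<exists>I\<in>even_idx n r. invertible_elem (u I))}"

definition ess_rel ::
  "'a::ring_1 set \<Rightarrow> 'a set \<Rightarrow> nat \<Rightarrow> nat \<Rightarrow> nat \<Rightarrow> ((nat list \<Rightarrow> 'a) \<times> (nat list \<Rightarrow> 'a)) set" where
  "ess_rel A0 A1 n m r =
    {(u, v). u \<in> ess_coords A0 A1 n m r \<and> v \<in> ess_coords A0 A1 n m r \<and>
      (\<exists>c\<in>A0. invertible_elem c \<and> (\<forall>I\<in>ess_idx n m r. v I = c * u I))}"

definition P_ess ::
  "'a::ring_1 set \<Rightarrow> 'a set \<Rightarrow> nat \<Rightarrow> nat \<Rightarrow> nat \<Rightarrow> (nat list \<Rightarrow> 'a) set set" where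
  "P_ess A0 A1 n m r = ess_coords A0 A1 n m r // ess_rel A0 A1 n m r"

text \<open>
  Extension of the coordinates to arbitrary multi-indices by antisymmetry. At most one permutation
  contributes to the sum, namely the one that sorts \<open>I\<close>; there is none if \<open>I\<close> has a repeated
  entry, and the value is then 0.
\<close>

definition antisym_ext :: "(nat list \<Rightarrow> 'a::ring_1) \<Rightarrow> nat list \<Rightarrow> 'a" where
  "antisym_ext u I =
    (\<Sum>p | p permutes {..<length I} \<and> sorted_wrt (<) (permute_list p I).
      of_int (sign p) * u (permute_list p I))"

text \<open>
  The determinant of a matrix over a ring that is not assumed commutative, each product taken in
  the order of the rows. For a matrix with even entries outside of a single odd column, the
  factors of each product commute, so the order does not matter and this is the determinant
  extended by multilinearity.
\<close>

definition sdet :: "'a::ring_1 mat \<Rightarrow> 'a" where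
  "sdet M = (\<Sum>p | p permutes {..<dim_row M}.
     of_int (sign p) * prod_list (map (\<lambda>i. M $$ (i, p i)) [0..<dim_row M]))"

definition col_submat :: "'a mat \<Rightarrow> nat list \<Rightarrow> 'a mat" where
  "col_submat U I = mat (dim_row U) (length I) (\<lambda>(i, j). U $$ (i, I ! j))"

text \<open>
  The points of \<open>GL(r)\<close> over the superalgebra. The inverse of an even matrix is again even.
\<close>

definition GL_even :: "'a::ring_1 set \<Rightarrow> nat \<Rightarrow> 'a mat set" where
  "GL_even A0 r = {g \<in> carrier_mat r r. elements_mat g \<subseteq> A0 \<and> invertible_mat g}"

definition gr_mats :: "'a::ring_1 set \<Rightarrow> 'a set \<Rightarrow> nat \<Rightarrow> nat \<Rightarrow> nat \<Rightarrow> 'a mat set" where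
  "gr_mats A0 A1 n m r =
    {U \<in> carrier_mat r (n + m).
      (\<forall>i<r. \<forall>a<n. U $$ (i, a) \<in> A0) \<and> (\<forall>i<r. \<forall>\<mu><m. U $$ (i, n + \<mu>) \<in> A1) \<and>
      (\<exists>I\<in>even_idx n r. invertible_mat (col_submat U I))}"

definition gr_rel ::
  "'a::ring_1 set \<Rightarrow> 'a set \<Rightarrow> nat \<Rightarrow> nat \<Rightarrow> nat \<Rightarrow> ('a mat \<times> 'a mat) set" where
  "gr_rel A0 A1 n m r =
    {(U, W). U \<in> gr_mats A0 A1 n m r \<and> W \<in> gr_mats A0 A1 n m r \<and> (\<exists>g\<in>GL_even A0 r. W = g * U)}"

definition Gr :: "'a::ring_1 set \<Rightarrow> 'a set \<Rightarrow> nat \<Rightarrow> nat \<Rightarrow> nat \<Rightarrow> 'a mat set set" where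
  "Gr A0 A1 n m r = gr_mats A0 A1 n m r // gr_rel A0 A1 n m r"

definition plucker_coords :: "nat \<Rightarrow> nat \<Rightarrow> nat \<Rightarrow> 'a::ring_1 mat \<Rightarrow> nat list \<Rightarrow> 'a" where
  "plucker_coords n m r U = (\<lambda>I\<in>ess_idx n m r. sdet (col_submat U I))"

definition plucker ::
  "'a::ring_1 set \<Rightarrow> 'a set \<Rightarrow> nat \<Rightarrow> nat \<Rightarrow> nat \<Rightarrow> 'a mat set \<Rightarrow> (nat list \<Rightarrow> 'a) set" where
  "plucker A0 A1 n m r X = (\<Union>U\<in>X. ess_rel A0 A1 n m r `` {plucker_coords n m r U})"

end

theory Submission
  imports Defs
begin

text \<open>
  Even elements are central, and every coordinate involves at most one odd column. So the
  computation can be done in the trivial extension of the centre \<open>Z\<close> of the algebra \<open>A\<close> by \<open>A\<close>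
  (pairs \<open>(c, x)\<close> with \<open>c \<in> Z\<close>, \<open>x \<in> A\<close> and \<open>(0, x) (0, y) = 0\<close>), with even \<open>c\<close> becoming \<open>(c, 0)\<close>
  and odd \<open>x\<close> becoming \<open>(0, x)\<close>. This is an honest commutative ring, so the classical theory of
  determinants applies there, and both families of relations become the classical exchange relation.

  That relation holds for determinants by expanding along a column and using the adjugate. Conversely,
  if \<open>u I\<close> is invertible, the matrix with entries \<open>u (I[i := a]) / u I\<close> has the identity in the
  columns \<open>I\<close>, and the exchange relation determines \<open>u\<close> from those entries, by induction on the
  number of indices outside \<open>I\<close>.
\<close>

section \<open>The central extension\<close>

definition central :: "'a::ring_1 \<Rightarrow> bool" where
  "central c \<longleftrightarrow> (\<forall>y. c * y = y * c)"

lemma central_commute: "central c \<Longrightarrow> y * c = c * y"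
  by (simp add: central_def)

lemma central_left_commute: "central c \<Longrightarrow> y * (c * z) = c * (y * z)"
  by (metis central_def mult.assoc)

lemma central_0 [simp]: "central 0"
  and central_1 [simp]: "central 1"
  by (simp_all add: central_def)

lemma central_add [simp]: "central a \<Longrightarrow> central b \<Longrightarrow> central (a + b)"
  by (simp add: central_def algebra_simps)

lemma central_uminus [simp]: "central a \<Longrightarrow> central (- a)"
  by (simp add: central_def)

lemma central_mult [simp]: "central a \<Longrightarrow> central b \<Longrightarrow> central (a * b)"
  unfolding central_def by (metis mult.assoc)

lemma central_sum: "(\<And>i. i \<in> A \<Longrightarrow> central (f i)) \<Longrightarrow> central (sum f A)"
  by (induction A rule: infinite_finite_induct) auto

text \<open>A type cannot depend on the set \<open>A0\<close>. The centre depends on the ring type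
  alone, and it contains \<open>A0\<close> by \<open>central_even\<close>.\<close>

typedef (overloaded) 'a central_ext = "{(c :: 'a :: ring_1, x :: 'a). central c}"
  by (rule exI[of _ "(0, 0)"]) simp

setup_lifting type_definition_central_ext

instantiation central_ext :: (ring_1) comm_ring_1
begin

lift_definition zero_central_ext :: "'a central_ext" is "(0, 0)" by simp
lift_definition one_central_ext :: "'a central_ext" is "(1, 0)" by simp
lift_definition plus_central_ext :: "'a central_ext \<Rightarrow> 'a central_ext \<Rightarrow> 'a central_ext"
  is "\<lambda>(c, x) (d, y). (c + d, x + y)" by auto
lift_definition uminus_central_ext :: "'a central_ext \<Rightarrow> 'a central_ext"
  is "\<lambda>(c, x). (- c, - x)" by auto
lift_definition minus_central_ext :: "'a central_ext \<Rightarrow> 'a central_ext \<Rightarrow> 'a central_ext"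
  is "\<lambda>(c, x) (d, y). (c - d, x - y)" by (auto simp: central_def algebra_simps)
lift_definition times_central_ext :: "'a central_ext \<Rightarrow> 'a central_ext \<Rightarrow> 'a central_ext"
  is "\<lambda>(c, x) (d, y). (c * d, c * y + d * x)" by auto

instance
proof
  fix a b c :: "'a central_ext"
  show "a * b * c = a * (b * c)"
    by transfer (auto simp: distrib_left mult.assoc central_left_commute add_ac)
  show "a * b = b * a" by transfer (auto simp: central_def)
  show "1 * a = a" by transfer auto
  show "(a + b) * c = a * c + b * c" by transfer (auto simp: algebra_simps)
  show "(0::'a central_ext) \<noteq> 1" by transfer simp
qed (transfer, auto simp: algebra_simps)+

end

text \<open>
  \<open>collapse\<close> is additive, but multiplicative only on factors that are not both odd. Products with
  at most one odd factor are the only ones that occur.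
\<close>

lift_definition collapse :: "'a::ring_1 central_ext \<Rightarrow> 'a" is "\<lambda>(c, x). c + x" .
lift_definition odd_part :: "'a::ring_1 central_ext \<Rightarrow> 'a" is snd .
text \<open>The value 0 off the centre makes the function total; hence the centrality hypotheses in
  its rules for sums and products.\<close>

lift_definition of_even :: "'a::ring_1 \<Rightarrow> 'a central_ext" is "\<lambda>c. (if central c then c else 0, 0)"
  by simp
lift_definition of_odd :: "'a::ring_1 \<Rightarrow> 'a central_ext" is "\<lambda>x. (0, x)" by simp

lemma collapse_simps [simp]:
  "collapse 0 = 0" "collapse 1 = 1" "collapse (a + b) = collapse a + collapse b" "collapse (- a) = - collapse a"
  "collapse (of_odd x) = x"
  by (transfer, auto)+

lemma collapse_of_even [simp]: "central c \<Longrightarrow> collapse (of_even c) = c"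
  by transfer simp

lemma collapse_sum: "collapse (sum f A) = (\<Sum>i\<in>A. collapse (f i))"
  by (induction A rule: infinite_finite_induct) auto

text \<open>In \<open>(c + x) * (d + y)\<close> the term \<open>x * y\<close> is the only one that
  the extension drops, and it vanishes when one odd part does. Centrality of \<open>d\<close> turns
  \<open>x * d\<close> into \<open>d * x\<close>.\<close>

lemma collapse_mult: "odd_part a = 0 \<or> odd_part b = 0 \<Longrightarrow> collapse (a * b) = collapse a * collapse b"
  by transfer (auto simp: algebra_simps central_commute)

lemma odd_part_simps [simp]:
  "odd_part 0 = 0" "odd_part 1 = 0" "odd_part (a + b) = odd_part a + odd_part b"
  "odd_part (- a) = - odd_part a" "odd_part (of_even c) = 0" "odd_part (of_odd x) = x"
  by (transfer, auto)+

lemma odd_part_mult: "odd_part a = 0 \<Longrightarrow> odd_part b = 0 \<Longrightarrow> odd_part (a * b) = 0"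
  by transfer auto

lemma odd_part_sum: "(\<And>i. i \<in> A \<Longrightarrow> odd_part (f i) = 0) \<Longrightarrow> odd_part (sum f A) = 0"
  by (induction A rule: infinite_finite_induct) auto

lemma odd_part_prod: "(\<And>i. i \<in> A \<Longrightarrow> odd_part (f i) = 0) \<Longrightarrow> odd_part (prod f A) = 0"
  by (induction A rule: infinite_finite_induct) (auto intro: odd_part_mult)

lemma of_even_simps [simp]:
  "of_even 0 = 0" "of_even 1 = 1" "central c \<Longrightarrow> of_even (- c) = - of_even c"
  by (transfer, auto)+

lemma of_even_add: "central c \<Longrightarrow> central d \<Longrightarrow> of_even (c + d) = of_even c + of_even d"
  by transfer auto

lemma of_even_mult: "central c \<Longrightarrow> central d \<Longrightarrow> of_even (c * d) = of_even c * of_even d"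
  by transfer auto

lemma of_odd_simps [simp]:
  "of_odd 0 = 0" "of_odd (- x) = - of_odd x" "of_odd (x + y) = of_odd x + of_odd y"
  by (transfer, auto)+

lemma of_even_mult_of_odd: "central c \<Longrightarrow> of_even c * of_odd x = of_odd (c * x)"
  by transfer auto

lemma of_even_sum:
  "(\<And>i. i \<in> A \<Longrightarrow> central (f i)) \<Longrightarrow> of_even (sum f A) = (\<Sum>i\<in>A. of_even (f i))"
  by (induction A rule: infinite_finite_induct) (auto simp: of_even_add central_sum)

lemma of_odd_sum: "of_odd (sum f A) = (\<Sum>i\<in>A. of_odd (f i))"
  by (induction A rule: infinite_finite_induct) auto

lemma collapse_sign_mult: "collapse (of_int (sign p) * a) = of_int (sign p) * collapse a"
  by (simp add: sign_def)

lemma odd_part_prod_list: "(\<And>x. x \<in> set xs \<Longrightarrow> odd_part x = 0) \<Longrightarrow> odd_part (prod_list xs) = 0"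
  by (induction xs) (auto intro: odd_part_mult)

text \<open>The hypothesis allows at most one entry with an odd part. So either the head or the
  product of the tail has none, and \<open>collapse_mult\<close> applies at every step.\<close>

lemma collapse_prod_list:
  assumes "\<And>i j. i < j \<Longrightarrow> j < length xs \<Longrightarrow> odd_part (xs ! i) = 0 \<or> odd_part (xs ! j) = 0"
  shows "collapse (prod_list xs) = prod_list (map collapse xs)"
  using assms
proof (induction xs)
  case (Cons a xs)
  have "odd_part a = 0 \<or> odd_part (prod_list xs) = 0"
  proof (rule disjCI)
    assume *: "odd_part (prod_list xs) \<noteq> 0"
    then obtain x where "x \<in> set xs" "odd_part x \<noteq> 0" using odd_part_prod_list by blast
    then obtain j where "j < length xs" "odd_part (xs ! j) \<noteq> 0" by (auto simp: in_set_conv_nth)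
    then show "odd_part a = 0" using Cons.prems[of 0 "Suc j"] by auto
  qed
  then have "collapse (a * prod_list xs) = collapse a * collapse (prod_list xs)" by (rule collapse_mult)
  moreover have "collapse (prod_list xs) = prod_list (map collapse xs)"
  proof (rule Cons.IH)
    fix i j assume "i < j" "j < length xs"
    then show "odd_part (xs ! i) = 0 \<or> odd_part (xs ! j) = 0"
      using Cons.prems[of "Suc i" "Suc j"] by simp
  qed
  ultimately show ?case by simp
qed simp

section \<open>Determinants with at most one odd column\<close>

text \<open>\<open>S\<close> collects the even columns. Parity is attached to the column because the
  ring element alone does not determine it: an odd element can be central too.\<close>

definition lift_cols :: "nat set \<Rightarrow> 'a::ring_1 mat \<Rightarrow> 'a central_ext mat" where
  "lift_cols S M = mat (dim_row M) (dim_col M)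
     (\<lambda>(i, j). if j \<in> S then of_even (M $$ (i, j)) else of_odd (M $$ (i, j)))"

lemma lift_cols_carrier [simp]: "M \<in> carrier_mat a b \<Longrightarrow> lift_cols S M \<in> carrier_mat a b"
  by (auto simp: lift_cols_def)

lemma odd_part_det:
  assumes "M \<in> carrier_mat r r" "\<And>i j. i < r \<Longrightarrow> j < r \<Longrightarrow> odd_part (M $$ (i, j)) = 0"
  shows "odd_part (det M) = 0"
proof -
  have *: "odd_part (of_int (sign p) :: 'a central_ext) = 0" for p :: "nat \<Rightarrow> nat"
    by (simp add: sign_def)
  show ?thesis
    unfolding det_def'[OF assms(1)]
    by (intro odd_part_sum odd_part_mult odd_part_prod *)
       (use permutes_in_image in \<open>fastforce intro!: assms(2)\<close>)+
qed

text \<open>At most one column lies outside \<open>S\<close>, so each Leibniz product has at most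
  one odd factor and \<open>collapse\<close> is multiplicative on it.\<close>

lemma sdet_eq_collapse_det:
  assumes M: "M \<in> carrier_mat r r"
    and cen: "\<And>i j. i < r \<Longrightarrow> j < r \<Longrightarrow> j \<in> S \<Longrightarrow> central (M $$ (i, j))"
    and S: "\<And>j k. j < r \<Longrightarrow> k < r \<Longrightarrow> j \<noteq> k \<Longrightarrow> j \<in> S \<or> k \<in> S"
  shows "sdet M = collapse (det (lift_cols S M))"
proof -
  have dims: "dim_row M = r" "dim_col M = r" using M by auto
  have eq: "collapse (\<Prod>i = 0..<r. lift_cols S M $$ (i, p i)) =
      prod_list (map (\<lambda>i. M $$ (i, p i)) [0..<r])" if p: "p permutes {0..<r}" for p
  proof -
    have lt: "p i < r" if "i < r" for i using permutes_in_image[OF p, of i] that by simp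
    have inj: "p i \<noteq> p j" if "i \<noteq> j" for i j using permutes_inj[OF p] that by (auto dest: injD)
    let ?xs = "map (\<lambda>i. lift_cols S M $$ (i, p i)) [0..<r]"
    \<comment> \<open>In the commutative extension the product may be taken in the order of the
      rows, which is the order in \<open>sdet\<close>.\<close>
    have "(\<Prod>i = 0..<r. lift_cols S M $$ (i, p i)) = prod_list ?xs"
      by (simp add: prod.distinct_set_conv_list[of "[0..<r]", simplified])
    also have "collapse (prod_list ?xs) = prod_list (map collapse ?xs)"
    proof (rule collapse_prod_list)
      fix i j assume ij: "i < j" "j < length ?xs"
      then have "p i \<in> S \<or> p j \<in> S" using S[of "p i" "p j"] lt inj[of i j] by simp
      then show "odd_part (?xs ! i) = 0 \<or> odd_part (?xs ! j) = 0"
        using ij lt dims by (auto simp: lift_cols_def)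
    qed
    also have "map collapse ?xs = map (\<lambda>i. M $$ (i, p i)) [0..<r]"
      using lt dims cen by (auto simp: lift_cols_def)
    finally show ?thesis .
  qed
  show ?thesis
    unfolding det_def'[OF lift_cols_carrier[OF M]] sdet_def dims collapse_sum
    by (rule sum.cong) (auto simp: collapse_sign_mult eq lessThan_atLeast0)
qed

text \<open>Lifting respects the matrix product because the entries of the left factor are even.
  Then \<open>det ?G\<close> has no odd part, so the product of the two determinants collapses
  factorwise.\<close>

lemma sdet_mult:
  assumes G: "G \<in> carrier_mat r r" "\<And>i j. i < r \<Longrightarrow> j < r \<Longrightarrow> central (G $$ (i, j))"
    and M: "M \<in> carrier_mat r r"
    and cen: "\<And>i j. i < r \<Longrightarrow> j < r \<Longrightarrow> j \<in> S \<Longrightarrow> central (M $$ (i, j))"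
    and S: "\<And>j k. j < r \<Longrightarrow> k < r \<Longrightarrow> j \<noteq> k \<Longrightarrow> j \<in> S \<or> k \<in> S"
  shows "sdet (G * M) = sdet G * sdet M"
proof -
  let ?G = "lift_cols UNIV G" and ?M = "lift_cols S M"
  have "lift_cols S (G * M) = ?G * ?M"
  proof (rule eq_matI)
    fix i j assume "i < dim_row (?G * ?M)" "j < dim_col (?G * ?M)"
    then have ij: "i < r" "j < r" using G M by (auto simp: lift_cols_def)
    show "lift_cols S (G * M) $$ (i, j) = (?G * ?M) $$ (i, j)"
      using ij G M cen
      by (auto simp: lift_cols_def scalar_prod_def of_even_sum of_odd_sum of_even_mult
          of_even_mult_of_odd of_even_sum[where A="{0..<r}"] intro!: sum.cong trans[OF of_even_sum])
  qed (use G M in \<open>auto simp: lift_cols_def\<close>)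
  moreover have "sdet (G * M) = collapse (det (lift_cols S (G * M)))"
  proof (rule sdet_eq_collapse_det)
    show "G * M \<in> carrier_mat r r" using G M by simp
    show "central ((G * M) $$ (i, j))" if "i < r" "j < r" "j \<in> S" for i j
      using that G M cen by (auto simp: scalar_prod_def intro!: central_sum)
  qed (rule S)
  moreover have "det (?G * ?M) = det ?G * det ?M"
    using G M by (intro det_mult[of _ r]) auto
  moreover have "odd_part (det ?G) = 0"
    by (rule odd_part_det[of _ r]) (use G in \<open>auto simp: lift_cols_def\<close>)
  moreover have "sdet G = collapse (det ?G)"
    by (rule sdet_eq_collapse_det) (use G in auto)
  moreover have "sdet M = collapse (det ?M)"
    by (rule sdet_eq_collapse_det[OF M cen S])
  ultimately show ?thesis by (simp add: collapse_mult)
qed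

lemma sdet_one: "sdet (1\<^sub>m r :: 'a::ring_1 mat) = 1"
proof -
  have "lift_cols UNIV (1\<^sub>m r) = (1\<^sub>m r :: 'a central_ext mat)"
    by (rule eq_matI) (auto simp: lift_cols_def)
  then show ?thesis
    using sdet_eq_collapse_det[of "1\<^sub>m r :: 'a mat" r UNIV] by simp
qed

text \<open>Entries are central if the matrix commutes with every scalar matrix. \<open>M\<close>
  does, and its inverse inherits this: \<open>B y = B y M B = B M y B = y B\<close>.\<close>

lemma central_inverse_mat:
  fixes M :: "'a::ring_1 mat"
  assumes M: "M \<in> carrier_mat r r" and cen: "\<And>i j. i < r \<Longrightarrow> j < r \<Longrightarrow> central (M $$ (i, j))"
    and B: "B \<in> carrier_mat r r" and MB: "M * B = 1\<^sub>m r" and BM: "B * M = 1\<^sub>m r"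
    and ij: "i < r" "j < r"
  shows "central (B $$ (i, j))"
  unfolding central_def
proof
  fix y
  let ?y = "y \<cdot>\<^sub>m 1\<^sub>m r :: 'a mat"
  have y: "?y \<in> carrier_mat r r" by simp
  have comm: "?y * M = M * ?y"
    using M cen[THEN central_commute] by (auto intro!: eq_matI sum.cong simp: scalar_prod_def
      if_distrib[of "\<lambda>x. _ * x"] if_distrib[of "\<lambda>x. x * _"] cong: if_cong)
  have "B * ?y = B * ?y * (M * B)" using B y MB by simp
  also have "\<dots> = B * (?y * M) * B"
    using assoc_mult_mat[OF B y, of "M * B" r] assoc_mult_mat[OF y M B]
      assoc_mult_mat[OF B mult_carrier_mat[OF y M] B] M B by simp
  also have "\<dots> = (B * M) * ?y * B"
    unfolding comm using assoc_mult_mat[OF B M y] by simp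
  also have "\<dots> = ?y * B" using B y BM by simp
  finally have "(B * ?y) $$ (i, j) = (?y * B) $$ (i, j)" by simp
  then show "B $$ (i, j) * y = y * B $$ (i, j)"
    using B ij by (simp add: scalar_prod_def if_distrib[of "\<lambda>x. _ * x"]
      if_distrib[of "\<lambda>x. x * _"] cong: if_cong)
qed

lemma invertible_sdet:
  assumes M: "M \<in> carrier_mat r r" and cen: "\<And>i j. i < r \<Longrightarrow> j < r \<Longrightarrow> central (M $$ (i, j))"
    and inv: "invertible_mat M"
  shows "invertible_elem (sdet M)"
proof -
  obtain B where "M * B = 1\<^sub>m r" and BM: "B * M = 1\<^sub>m (dim_row B)"
    using inv M unfolding invertible_mat_def inverts_mat_def by auto
  \<comment> \<open>The definition of an inverse does not fix the shape of \<open>B\<close>; both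
    dimensions are read off from the two products.\<close>
  then have MB: "M * B = 1\<^sub>m r" and B: "B \<in> carrier_mat r r"
    using M by (metis carrier_matD carrier_matI index_mult_mat(2,3) index_one_mat(2,3))+
  have BM: "B * M = 1\<^sub>m r" using BM B by simp
  note cenB = central_inverse_mat[OF M cen B MB BM]
  have "sdet M * sdet B = 1"
    using sdet_mult[OF M cen B, of UNIV] cenB by (simp add: MB sdet_one)
  moreover have "sdet B * sdet M = 1"
    using sdet_mult[OF B cenB M, of UNIV] cen by (simp add: BM sdet_one)
  ultimately show ?thesis unfolding invertible_elem_def by blast
qed

section \<open>The exchange relation over a commutative ring\<close>

text \<open>The second condition is imposed separately: for a repeated entry the sign rule gives
  only \<open>f J = - f J\<close>, which says nothing in characteristic 2.\<close>

definition alternating :: "nat \<Rightarrow> (nat list \<Rightarrow> 'a::ring_1) \<Rightarrow> bool" where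
  "alternating r f \<longleftrightarrow>
    (\<forall>J p. length J = r \<longrightarrow> p permutes {..<r} \<longrightarrow> f (permute_list p J) = of_int (sign p) * f J) \<and>
    (\<forall>J. length J = r \<longrightarrow> \<not> distinct J \<longrightarrow> f J = 0)"

lemma alternating_permute:
  "alternating r f \<Longrightarrow> length J = r \<Longrightarrow> p permutes {..<r} \<Longrightarrow>
    f (permute_list p J) = of_int (sign p) * f J"
  by (simp add: alternating_def)

lemma alternating_not_distinct:
  "alternating r f \<Longrightarrow> length J = r \<Longrightarrow> \<not> distinct J \<Longrightarrow> f J = 0"
  by (simp add: alternating_def)

lemma sign_mult_cancel: "of_int (sign p) * (of_int (sign p) * x) = (x :: 'a::ring_1)"
  by (simp add: sign_def)

lemma permute_list_update:
  assumes p: "p permutes {..<length J}" and j: "j < length J"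
  shows "permute_list p (J[p j := x]) = (permute_list p J)[j := x]"
proof (rule nth_equalityI)
  fix i assume "i < length (permute_list p (J[p j := x]))"
  then have i: "i < length J" by simp
  have "p i < length J" using permutes_in_image[OF p, of i] i by simp
  moreover have "p j \<noteq> p i" if "j \<noteq> i" using permutes_inj[OF p] that by (auto dest: injD)
  ultimately show "permute_list p (J[p j := x]) ! i = (permute_list p J)[j := x] ! i"
    using i j p by (cases "j = i") (auto simp: permute_list_nth nth_list_update)
qed simp

lemma alternating_eq_of_perm:
  assumes f: "alternating r f" and g: "alternating r g" and "length I = r" "length J = r"
    and "mset J = mset I" and "f I = g I"
  shows "f J = g J"
proof -
  obtain p where "p permutes {..<length I}" "permute_list p I = J"
    using mset_eq_permutation[OF assms(5)] by blast
  then show ?thesis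
    using alternating_permute[OF f, of I p] alternating_permute[OF g, of I p] assms by auto
qed

text \<open>The entry at position \<open>k\<close> of \<open>as\<close> is traded against each entry
  of \<open>bs\<close>. The Pluecker relations are the case \<open>k = 0\<close>; recovering a
  matrix from its minors uses every \<open>k\<close>.\<close>

definition exchange_rel :: "nat \<Rightarrow> (nat list \<Rightarrow> 'a::ring_1) \<Rightarrow> nat \<Rightarrow> nat list \<Rightarrow> nat list \<Rightarrow> bool" where
  "exchange_rel r f k as bs \<longleftrightarrow>
    f as * f bs = (\<Sum>j<r. f (as[k := bs ! j]) * f (bs[j := as ! k]))"

text \<open>Permuting \<open>bs\<close> multiplies the left side and every summand by
  \<open>sign q\<close> and merely reindexes the sum by \<open>q\<close>.\<close>

lemma exchange_rel_permute_right:
  assumes f: "alternating r f" and len: "length as = r" "length bs = r" and q: "q permutes {..<r}"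
    and rel: "exchange_rel r f k as (permute_list q bs)"
  shows "exchange_rel r f k as bs"
proof -
  let ?s = "of_int (sign q) :: 'a"
  have eq: "f (as[k := permute_list q bs ! j]) * f ((permute_list q bs)[j := as ! k])
      = ?s * (f (as[k := bs ! q j]) * f (bs[q j := as ! k]))" if "j < r" for j
  proof -
    have "f ((permute_list q bs)[j := as ! k]) = ?s * f (bs[q j := as ! k])"
      using permute_list_update[of q bs j "as ! k"] q len that
        alternating_permute[OF f _ q, of "bs[q j := as ! k]"] by simp
    then show ?thesis
      using q len that by (simp add: permute_list_nth sign_def)
  qed
  have "f as * f bs = ?s * (f as * f (permute_list q bs))"
    using alternating_permute[OF f len(2) q] by (simp add: sign_def)
  also have "\<dots> = (\<Sum>j<r. f (as[k := bs ! q j]) * f (bs[q j := as ! k]))"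
    using rel unfolding exchange_rel_def
    by (simp add: eq sum_distrib_left sign_mult_cancel cong: sum.cong_simp)
  also have "\<dots> = (\<Sum>j<r. f (as[k := bs ! j]) * f (bs[j := as ! k]))"
    using sum.permute[OF q, of "\<lambda>j. f (as[k := bs ! j]) * f (bs[j := as ! k])"] by (simp add: o_def)
  finally show ?thesis by (simp add: exchange_rel_def)
qed

text \<open>Both sides acquire the factor \<open>sign q\<close>, while the distinguished position
  moves from \<open>k\<close> to \<open>q k\<close>. A transposition thus carries the relation from
  position 0 to any other.\<close>

lemma exchange_rel_permute_left:
  assumes f: "alternating r f" and len: "length as = r" "length bs = r" and q: "q permutes {..<r}"
    and k: "k < r" and rel: "exchange_rel r f k (permute_list q as) bs"
  shows "exchange_rel r f (q k) as bs"
proof -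
  let ?s = "of_int (sign q) :: 'a"
  have eq: "f ((permute_list q as)[k := x]) = ?s * f (as[q k := x])" for x
    using permute_list_update[of q as k x] q len k
        alternating_permute[OF f _ q, of "as[q k := x]"] by simp
  have "f as * f bs = ?s * (f (permute_list q as) * f bs)"
    using alternating_permute[OF f len(1) q] by (simp add: sign_def)
  also have "\<dots> = (\<Sum>j<r. f (as[q k := bs ! j]) * f (bs[j := as ! q k]))"
    using rel q len k unfolding exchange_rel_def
    by (simp add: eq sum_distrib_left sign_mult_cancel permute_list_nth mult.assoc)
  finally show ?thesis by (simp add: exchange_rel_def)
qed

section \<open>Maximal minors of a matrix over a commutative ring\<close>

lemma col_submat_carrier [simp]:
  "M \<in> carrier_mat r N \<Longrightarrow> length J = r \<Longrightarrow> col_submat M J \<in> carrier_mat r r"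
  by (auto simp: col_submat_def)

lemma col_submat_index [simp]:
  "i < dim_row M \<Longrightarrow> j < length J \<Longrightarrow> col_submat M J $$ (i, j) = M $$ (i, J ! j)"
  by (simp add: col_submat_def)

lemma alternating_det:
  fixes M :: "'a::comm_ring_1 mat"
  assumes M: "M \<in> carrier_mat r N"
  shows "alternating r (\<lambda>J. det (col_submat M J))"
  unfolding alternating_def
proof (intro conjI allI impI)
  fix J :: "nat list" and p
  assume J: "length J = r" and p: "p permutes {..<r}"
  let ?A = "transpose_mat (col_submat M J)"
  have lt: "p j < r" if "j < r" for j using permutes_in_image[OF p, of j] that by simp
  have "transpose_mat (col_submat M (permute_list p J)) = mat r r (\<lambda>(i, j). ?A $$ (p i, j))"
    using M J p lt by (auto intro!: eq_matI simp: col_submat_def permute_list_nth)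
  moreover have "?A \<in> carrier_mat r r" using M J by simp
  ultimately have "det (transpose_mat (col_submat M (permute_list p J))) = of_int (sign p) * det ?A"
    using det_permute_rows[of ?A r p] p by (simp add: atLeast0LessThan)
  then show "det (col_submat M (permute_list p J)) = of_int (sign p) * det (col_submat M J)"
    using M J by (simp add: det_transpose[of _ r])
next
  fix J :: "nat list"
  assume J: "length J = r" and "\<not> distinct J"
  then obtain i j where ij: "i < r" "j < r" "i \<noteq> j" "J ! i = J ! j"
    by (auto simp: distinct_conv_nth)
  show "det (col_submat M J) = 0"
    by (rule det_identical_columns[of _ r i j]) (use M J ij in \<open>auto simp: col_submat_def intro!: eq_vecI\<close>)
qed

text \<open>In the Laplace expansion along column \<open>k\<close> the cofactors ignore that column,
  so they are those of \<open>J\<close> itself.\<close>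

lemma det_col_submat_update:
  fixes M :: "'a::comm_ring_1 mat"
  assumes M: "M \<in> carrier_mat r N" and J: "length J = r" and k: "k < r"
  shows "det (col_submat M (J[k := x])) = (\<Sum>i<r. M $$ (i, x) * cofactor (col_submat M J) i k)"
proof -
  have "cofactor (col_submat M (J[k := x])) i k = cofactor (col_submat M J) i k" if "i < r" for i
    unfolding cofactor_def
    by (rule arg_cong[of _ _ "\<lambda>A. _ * det A"])
       (use M J k that in \<open>auto intro!: eq_matI simp: mat_delete_def col_submat_def\<close>)
  then show ?thesis
    using M J k by (subst laplace_expansion_column[of _ r k]) (auto intro!: sum.cong)
qed

text \<open>After both factors of each summand are expanded, summing over \<open>j\<close> first
  produces an entry of \<open>?B * adj_mat ?B\<close>: \<open>det ?B\<close> on the diagonal, 0 off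
  it. What remains is the expansion of \<open>det ?A\<close> along column \<open>k\<close>.\<close>

lemma exchange_rel_det:
  fixes M :: "'a::comm_ring_1 mat"
  assumes M: "M \<in> carrier_mat r N" and as: "length as = r" and bs: "length bs = r" and k: "k < r"
  shows "exchange_rel r (\<lambda>J. det (col_submat M J)) k as bs"
proof -
  let ?A = "col_submat M as" and ?B = "col_submat M bs"
  have B: "?B \<in> carrier_mat r r" using M bs by simp
  have adj: "(\<Sum>j<r. M $$ (l, bs ! j) * cofactor ?B i j) = (if l = i then det ?B else 0)"
    if "l < r" "i < r" for l i
  proof -
    have "(?B * adj_mat ?B) $$ (l, i) = (det ?B \<cdot>\<^sub>m 1\<^sub>m r) $$ (l, i)" using adj_mat(2)[OF B] by simp
    then show ?thesis
      using that M bs by (simp add: scalar_prod_def adj_mat_def col_submat_def atLeast0LessThan)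
  qed
  have "(\<Sum>j<r. det (col_submat M (as[k := bs ! j])) * det (col_submat M (bs[j := as ! k])))
     = (\<Sum>j<r. \<Sum>l<r. \<Sum>i<r. M $$ (l, bs ! j) * cofactor ?A l k * (M $$ (i, as ! k) * cofactor ?B i j))"
    by (simp add: det_col_submat_update[OF M as k] det_col_submat_update[OF M bs] sum_product)
  also have "\<dots> = (\<Sum>l<r. \<Sum>i<r. \<Sum>j<r. M $$ (l, bs ! j) * cofactor ?A l k * (M $$ (i, as ! k) * cofactor ?B i j))"
    by (subst sum.swap, rule sum.cong[OF refl], rule sum.swap)
  also have "\<dots> = (\<Sum>l<r. \<Sum>i<r. cofactor ?A l k * M $$ (i, as ! k) * (\<Sum>j<r. M $$ (l, bs ! j) * cofactor ?B i j))"
    by (simp add: sum_distrib_left ac_simps)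
  also have "\<dots> = (\<Sum>l<r. cofactor ?A l k * M $$ (l, as ! k) * det ?B)"
    by (simp add: adj if_distrib[of "\<lambda>x. _ * x"] cong: if_cong sum.cong_simp)
  also have "\<dots> = det (col_submat M (as[k := as ! k])) * det ?B"
    unfolding det_col_submat_update[OF M as k] by (simp add: sum_distrib_left ac_simps)
  finally show ?thesis by (simp add: exchange_rel_def)
qed

section \<open>Recovering a matrix from the exchange relation\<close>

text \<open>With \<open>I\<close> on the left, the relation expresses \<open>f J\<close> through
  indices with fewer entries outside \<open>I\<close>, and the minors of \<open>M\<close> obey the
  same recursion from the same start. The abstract class \<open>P\<close>, closed under replacing an
  entry by one of \<open>I\<close>, will be the indices with at most one odd entry.\<close>

lemma exchange_rel_imp_det:
  fixes f :: "nat list \<Rightarrow> 'a::comm_ring_1"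
  assumes f: "alternating r f" and I: "distinct I" "length I = r" and r: "0 < r"
    and d: "f I * d = 1"
    and rel: "\<And>as bs. set as = set I \<Longrightarrow> length as = r \<Longrightarrow> length bs = r \<Longrightarrow> P bs \<Longrightarrow> exchange_rel r f 0 as bs"
    and P: "\<And>bs j a. P bs \<Longrightarrow> j < r \<Longrightarrow> a \<in> set I \<Longrightarrow> P (bs[j := a])"
    and PN: "\<And>bs. P bs \<Longrightarrow> set bs \<subseteq> {..<N}" and IN: "set I \<subseteq> {..<N}"
    and M: "M \<in> carrier_mat r N"
    and M_entry: "\<And>i a. i < r \<Longrightarrow> a < N \<Longrightarrow> M $$ (i, a) = d * f (I[i := a])"
    and J: "P J" "length J = r"
  shows "f J = f I * det (col_submat M J)"
proof -
  let ?D = "\<lambda>J. det (col_submat M J)"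
  let ?g = "\<lambda>J. f I * ?D J"
  have D: "alternating r ?D" by (rule alternating_det[OF M])
  have g: "alternating r ?g"
    using D unfolding alternating_def by (auto simp: ac_simps)
  have I1: "col_submat M I = 1\<^sub>m r"
  proof (rule eq_matI)
    fix i j assume "i < dim_row (1\<^sub>m r :: 'a mat)" "j < dim_col (1\<^sub>m r :: 'a mat)"
    then have ij: "i < r" "j < r" by auto
    have "I ! j < N" using IN ij I nth_mem by blast
    moreover have "f (I[i := I ! j]) = 0" if "i \<noteq> j"
    proof (rule alternating_not_distinct[OF f])
      show "\<not> distinct (I[i := I ! j])"
        using ij I that nth_eq_iff_index_eq[of "I[i := I ! j]" i j] by auto
    qed (simp add: I)
    ultimately show "col_submat M I $$ (i, j) = 1\<^sub>m r $$ (i, j)"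
      using ij M I d by (auto simp: M_entry mult.commute)
  qed (use M I in \<open>auto simp: col_submat_def\<close>)
  \<comment> \<open>\<open>I[k := a]\<close> selects the identity matrix with column
    \<open>k\<close> replaced by column \<open>a\<close> of \<open>M\<close>; by Cramer's rule its
    determinant is the entry \<open>M $$ (k, a)\<close>.\<close>
  have fD1: "f (I[k := a]) = f I * ?D (I[k := a])" if k: "k < r" and a: "a < N" for k a
  proof -
    have "col_submat M (I[k := a]) = replace_col (1\<^sub>m r) (1\<^sub>m r *\<^sub>v col M a) k"
    proof (rule eq_matI)
      fix i j assume "i < dim_row (replace_col (1\<^sub>m r) (1\<^sub>m r *\<^sub>v col M a) k)"
        "j < dim_col (replace_col (1\<^sub>m r) (1\<^sub>m r *\<^sub>v col M a) k)"
      then have ij: "i < r" "j < r" by (auto simp: replace_col_def)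
      then have "col_submat M I $$ (i, j) = 1\<^sub>m r $$ (i, j)" by (simp add: I1)
      then show "col_submat M (I[k := a]) $$ (i, j) = replace_col (1\<^sub>m r) (1\<^sub>m r *\<^sub>v col M a) k $$ (i, j)"
        using ij M a k I by (auto simp: replace_col_def)
    qed (use M I in \<open>auto simp: col_submat_def replace_col_def\<close>)
    then have "?D (I[k := a]) = M $$ (k, a)"
      using cramer_lemma_mat[of "1\<^sub>m r" r "col M a" k] M a k by auto
    then show ?thesis using d by (simp add: M_entry k a flip: mult.assoc)
  qed
  have rel_k: "exchange_rel r f k I bs" if k: "k < r" and bs: "P bs" "length bs = r" for k bs
  proof -
    \<comment> \<open>The permuted \<open>I\<close> has the same set of entries, so
      \<open>rel\<close> applies to it at position 0, and this is position \<open>k\<close> of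
      \<open>I\<close>.\<close>
    let ?q = "Transposition.transpose 0 k"
    have q: "?q permutes {..<r}" using k r by (intro permutes_swap_id) auto
    have "exchange_rel r f 0 (permute_list ?q I) bs"
      using q I bs by (intro rel) auto
    then have "exchange_rel r f (?q 0) I bs"
      by (rule exchange_rel_permute_left[OF f I(2) bs(2) q r])
    then show ?thesis by simp
  qed
  show ?thesis
    using J
  proof (induction "card (set J - set I)" arbitrary: J rule: less_induct)
    case less
    show ?case
    proof (cases "distinct J \<and> set J \<noteq> set I")
      \<comment> \<open>Base cases: a repeated entry makes both sides vanish, and a rearrangement of
        \<open>I\<close> follows from \<open>?D I = 1\<close> because both sides alternate.\<close>
      case False
      show ?thesis
      proof (cases "distinct J")
        case True
        then have "set J = set I" using False by simp
        then have "mset J = mset I" using True I by (simp add: set_eq_iff_mset_eq_distinct)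
        then show ?thesis
          by (rule alternating_eq_of_perm[OF f g I(2) less.prems(2)]) (simp add: I1)
      next
        case False
        then show ?thesis
          using alternating_not_distinct[OF f] alternating_not_distinct[OF g] less.prems by simp
      qed
    next
      case True
      have "card (set I) = card (set J)" using True I less.prems by (simp add: distinct_card)
      then have "\<not> set I \<subseteq> set J" using True card_subset_eq[of "set J" "set I"] by auto
      then obtain k where k: "k < r" "I ! k \<notin> set J"
        using I by (auto simp: subset_iff in_set_conv_nth)
      \<comment> \<open>As \<open>I ! k\<close> is not in \<open>J\<close>, each term of the exchange relation either has a repeated index or
        brings \<open>J\<close> closer to \<open>I\<close>.\<close>
      have PJ: "P J" "length J = r" by fact+
      have summand: "f (I[k := J ! j]) * f (J[j := I ! k])
          = f I * f I * (?D (I[k := J ! j]) * ?D (J[j := I ! k]))" if j: "j < r" for j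
      proof (cases "J ! j \<in> set I")
        case True
        then obtain l where l: "l < r" "I ! l = J ! j" using I by (auto simp: in_set_conv_nth)
        moreover have "l \<noteq> k" using l k j PJ by (metis nth_mem)
        ultimately have "\<not> distinct (I[k := J ! j])"
          using k I nth_eq_iff_index_eq[of "I[k := J ! j]" k l] by auto
        then show ?thesis
          using alternating_not_distinct[OF f] alternating_not_distinct[OF D] I by simp
      next
        case False
        have "set (J[j := I ! k]) - set I \<subset> set J - set I"
        proof
          show "set (J[j := I ! k]) - set I \<subseteq> set J - set I"
            using set_update_subset_insert[of J j "I ! k"] k I by auto
          have "J ! j \<notin> set (J[j := I ! k])"
            using \<open>distinct J \<and> _\<close> j PJ k
            by (metis distinct_list_update nth_list_update_eq in_set_conv_nth length_list_update
                nth_list_update_neq nth_eq_iff_index_eq nth_mem)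
          then show "set (J[j := I ! k]) - set I \<noteq> set J - set I"
            using False j PJ by (metis DiffD1 DiffI nth_mem)
        qed
        then have "card (set (J[j := I ! k]) - set I) < card (set J - set I)"
          by (intro psubset_card_mono) auto
        then have "f (J[j := I ! k]) = f I * ?D (J[j := I ! k])"
          using less.hyps P[OF PJ(1) j, of "I ! k"] k I PJ by simp
        moreover have "J ! j < N" using PN[OF PJ(1)] j PJ(2) nth_mem by blast
        ultimately show ?thesis using fD1[OF k(1)] by (simp add: ac_simps)
      qed
      have "f I * f J = (\<Sum>j<r. f (I[k := J ! j]) * f (J[j := I ! k]))"
        using rel_k[OF k(1) PJ] by (simp add: exchange_rel_def)
      \<comment> \<open>The minors of \<open>M\<close> satisfy the same exchange relation, and the
        two sums agree term by term up to the factor \<open>f I * f I\<close>.\<close>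
      also have "\<dots> = f I * f I * (?D I * ?D J)"
        using exchange_rel_det[OF M I(2) PJ(2) k(1)] unfolding exchange_rel_def
        by (simp add: summand sum_distrib_left)
      also have "\<dots> = f I * ?g J" by (simp add: I1)
      finally have "d * f I * f J = d * f I * ?g J" by (simp add: mult.assoc)
      then show ?thesis using d by (simp add: mult.commute[of d])
    qed
  qed
qed

section \<open>Multi-indices with at most one odd entry\<close>

text \<open>Substituting \<open>q \<circ> p\<close> for \<open>p\<close> permutes the summation
  range and produces the factor \<open>sign q\<close>. If an entry is repeated, no rearrangement is
  strictly increasing and the sum is empty.\<close>

lemma alternating_antisym_ext: "alternating r (antisym_ext u)"
  unfolding alternating_def
proof (intro conjI allI impI)
  fix J :: "nat list" and q
  assume J: "length J = r" and q: "q permutes {..<r}"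
  have pl: "permute_list p (permute_list q J) = permute_list (q \<circ> p) J" if "p permutes {..<r}" for p
    using permute_list_compose[of p J q] that J by simp
  have sgn: "of_int (sign q) * (of_int (sign (q \<circ> p)) * x) = (of_int (sign p) * x :: 'a)"
    if "p permutes {..<r}" for p x
  proof -
    have "permutation q" "permutation p"
      using that q by (auto intro: permutes_imp_permutation[of "{..<r}"])
    then have "sign q * sign (q \<circ> p) = sign p"
      by (simp add: sign_compose flip: mult.assoc)
    then show ?thesis by (metis mult.assoc of_int_mult)
  qed
  have "antisym_ext u (permute_list q J) =
      (\<Sum>p | p permutes {..<r} \<and> sorted_wrt (<) (permute_list (q \<circ> p) J).
        of_int (sign q) * (of_int (sign (q \<circ> p)) * u (permute_list (q \<circ> p) J)))"
    unfolding antisym_ext_def using J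
    by (intro sum.cong) (auto simp: pl sgn)
  also have "\<dots> = (\<Sum>p | p permutes {..<r} \<and> sorted_wrt (<) (permute_list p J).
        of_int (sign q) * (of_int (sign p) * u (permute_list p J)))"
    by (rule sum.reindex_bij_witness[where i = "\<lambda>p. Hilbert_Choice.inv q \<circ> p" and j = "\<lambda>p. q \<circ> p"])
       (use q in \<open>auto simp: permutes_compose permutes_inv permutes_inv_o o_assoc\<close>)
  finally show "antisym_ext u (permute_list q J) = of_int (sign q) * antisym_ext u J"
    using J by (simp add: antisym_ext_def sum_distrib_left)
next
  fix J :: "nat list"
  assume "length J = r" "\<not> distinct J"
  then have "\<not> sorted_wrt (<) (permute_list p J)" if "p permutes {..<length J}" for p
    using that by (metis strict_sorted_iff distinct_permute_list)
  then have "{p. p permutes {..<length J} \<and> sorted_wrt (<) (permute_list p J)} = {}"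
    by blast
  then show "antisym_ext u J = 0" unfolding antisym_ext_def by (metis sum.empty)
qed

text \<open>The identity is the only permutation that keeps a strictly increasing list strictly
  increasing.\<close>

lemma antisym_ext_sorted:
  assumes J: "sorted_wrt (<) J"
  shows "antisym_ext u J = u J"
proof -
  have "p = id" if p: "p permutes {..<length J}" and s: "sorted_wrt (<) (permute_list p J)" for p
  proof
    fix i
    have "permute_list p J = J"
      using properties_for_sort[of "permute_list p J" J] s J p
      by (simp add: strict_sorted_iff sorted_sort_id)
    then have "J ! p i = J ! i" if "i < length J" using that p by (metis permute_list_nth)
    moreover have "p i < length J" if "i < length J" using permutes_in_image[OF p, of i] that by simp
    ultimately show "p i = id i"
      using J permutes_not_in[OF p, of i]
      by (cases "i < length J") (auto simp: strict_sorted_iff nth_eq_iff_index_eq)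
  qed
  then have "{p. p permutes {..<length J} \<and> sorted_wrt (<) (permute_list p J)} = {id}"
    using J by (auto simp: permutes_id)
  then show ?thesis by (simp add: antisym_ext_def)
qed

lemma set_subset_lessThan_iff: "set J \<subseteq> {..<n} \<longleftrightarrow> (\<forall>i<length J. J ! i < n)"
  by (auto simp: set_conv_nth)

lemma list_update_subset_lessThan_iff:
  assumes "i < length J"
  shows "set (J[i := a]) \<subseteq> {..<n} \<longleftrightarrow> a < n \<and> (\<forall>j<length J. j \<noteq> i \<longrightarrow> J ! j < n)"
  unfolding set_subset_lessThan_iff using assms
  by (metis length_list_update nth_list_update_eq nth_list_update_neq)

text \<open>"At most one odd entry", phrased through pairs of positions. The odd entry may stand
  anywhere and even entries may repeat, so that the class is stable under permutations and under
  inserting even indices.\<close>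

definition good_idx :: "nat \<Rightarrow> nat \<Rightarrow> nat \<Rightarrow> nat list \<Rightarrow> bool" where
  "good_idx n m r J \<longleftrightarrow> length J = r \<and> set J \<subseteq> {..<n + m} \<and>
    (\<forall>i<r. \<forall>j<r. i \<noteq> j \<longrightarrow> J ! i < n \<or> J ! j < n)"

lemma good_idx_even: "length J = r \<Longrightarrow> set J \<subseteq> {..<n} \<Longrightarrow> good_idx n m r J"
  by (auto simp: good_idx_def set_subset_lessThan_iff)

lemma good_idx_length: "good_idx n m r J \<Longrightarrow> length J = r"
  by (simp add: good_idx_def)

lemma good_idx_nth: "good_idx n m r J \<Longrightarrow> i < r \<Longrightarrow> J ! i < n + m"
  by (simp add: good_idx_def set_subset_lessThan_iff)

lemma good_idx_update:
  assumes "good_idx n m r J" "a < n"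
  shows "good_idx n m r (J[j := a])"
  using assms
  by (cases "j < length J") (auto simp: good_idx_def set_subset_lessThan_iff nth_list_update)

lemma good_idx_permute:
  assumes J: "good_idx n m r J" and p: "p permutes {..<r}"
  shows "good_idx n m r (permute_list p J)"
proof -
  have "p i < r" if "i < r" for i using permutes_in_image[OF p, of i] that by simp
  moreover have "p i \<noteq> p j" if "i \<noteq> j" for i j using permutes_inj[OF p] that by (auto dest: injD)
  ultimately show ?thesis
    using J p by (auto simp: good_idx_def permute_list_nth)
qed

lemma good_idx_append:
  assumes "length bs = r - 1" "1 \<le> r" "set bs \<subseteq> {..<n}" "a < n + m"
  shows "good_idx n m r (bs @ [a])"
  using assms by (auto simp: good_idx_def set_subset_lessThan_iff nth_append not_less_eq)

lemma good_idx_ess: "1 \<le> r \<Longrightarrow> J \<in> ess_idx n m r \<Longrightarrow> good_idx n m r J"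
  by (auto simp: ess_idx_def even_idx_def odd_idx_def intro: good_idx_even good_idx_append)

lemma ess_idx_sorted: "J \<in> ess_idx n m r \<Longrightarrow> sorted_wrt (<) J"
  by (fastforce simp: ess_idx_def even_idx_def odd_idx_def sorted_wrt_append)

lemma good_idx_snoc:
  assumes J: "good_idx n m r J" and "1 \<le> r" and "n \<le> J ! (r - 1)"
  obtains bs \<mu> where "J = bs @ [n + \<mu>]" "\<mu> < m" "length bs = r - 1" "set bs \<subseteq> {..<n}"
proof
  have len: "length J = r" using J by (rule good_idx_length)
  then have "J \<noteq> []" using assms by auto
  then have l: "last J = J ! (r - 1)" by (simp add: last_conv_nth len)
  show "J = butlast J @ [n + (last J - n)]" 
    using append_butlast_last_id[OF \<open>J \<noteq> []\<close>] assms l by simp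
  show "last J - n < m" using good_idx_nth[OF J, of "r - 1"] l assms by simp
  show "length (butlast J) = r - 1" using len by simp
  show "set (butlast J) \<subseteq> {..<n}"
  proof
    fix x assume "x \<in> set (butlast J)"
    then obtain i where i: "i < r - 1" "x = J ! i"
      using len by (auto simp: in_set_conv_nth nth_butlast)
    have "\<forall>i<r. \<forall>j<r. i \<noteq> j \<longrightarrow> J ! i < n \<or> J ! j < n" using J by (simp add: good_idx_def)
    from this[rule_format, of i "r - 1"] show "x \<in> {..<n}" using i assms by auto
  qed
qed

text \<open>Odd indices are numbered from \<open>n\<close> upwards, so in an increasing list the odd
  entry, if any, stands last, as \<open>odd_idx\<close> demands.\<close>

lemma good_idx_sorted:
  assumes J: "good_idx n m r J" and r: "1 \<le> r" and s: "sorted_wrt (<) J"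
  shows "if set J \<subseteq> {..<n} then J \<in> even_idx n r else J \<in> odd_idx n m r"
proof (cases "set J \<subseteq> {..<n}")
  case True
  then show ?thesis using s J by (simp add: even_idx_def good_idx_length)
next
  case False
  have len: "length J = r" using J by (rule good_idx_length)
  obtain k where k: "k < r" "n \<le> J ! k" using False len
    by (auto simp: set_subset_lessThan_iff not_less)
  have "J ! k \<le> J ! (r - 1)"
    using s k len by (cases "k = r - 1") (auto simp: sorted_wrt_iff_nth_less intro: less_imp_le)
  then have "n \<le> J ! (r - 1)" using k by simp
  then obtain bs \<mu> where "J = bs @ [n + \<mu>]" "\<mu> < m" "length bs = r - 1" "set bs \<subseteq> {..<n}"
    using good_idx_snoc[OF J r] by metis
  then have "J \<in> odd_idx n m r"
    using s by (auto simp: odd_idx_def even_idx_def sorted_wrt_append)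
  then show ?thesis using False by simp
qed

text \<open>\<open>p\<close> and \<open>K\<close> are chosen before \<open>u\<close>, so that one
  choice serves two coordinate functions at once, as in \<open>antisym_ext_scale\<close>.\<close>

lemma antisym_ext_good_idx:
  fixes J :: "nat list"
  assumes J: "good_idx n m r J" and r: "1 \<le> r" and "distinct J"
  shows "\<exists>p K. p permutes {..<r} \<and> K = permute_list p J \<and> K \<in> ess_idx n m r \<and>
    (if set J \<subseteq> {..<n} then K \<in> even_idx n r else K \<in> odd_idx n m r) \<and>
    (\<forall>u :: nat list \<Rightarrow> 'a::ring_1. antisym_ext u J = of_int (sign p) * u K)"
proof -
  have len: "length J = r" using J by (rule good_idx_length)
  obtain p where p: "p permutes {..<r}" "permute_list p J = sort J"
    using mset_eq_permutation[of "sort J" J] len by auto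
  let ?K = "sort J"
  have s: "sorted_wrt (<) ?K" using \<open>distinct J\<close> by (simp add: strict_sorted_iff)
  have K: "if set J \<subseteq> {..<n} then ?K \<in> even_idx n r else ?K \<in> odd_idx n m r"
    using good_idx_sorted[OF _ r s] good_idx_permute[OF J p(1)] p by simp
  have "antisym_ext u J = of_int (sign p) * u ?K" for u :: "nat list \<Rightarrow> 'a"
    using alternating_permute[OF alternating_antisym_ext len p(1), of u]
      antisym_ext_sorted[OF s, of u] p by (simp add: sign_mult_cancel)
  moreover have "?K \<in> ess_idx n m r" using K by (auto simp: ess_idx_def split: if_splits)
  ultimately show ?thesis using K p by (intro exI[of _ p] exI[of _ ?K]) auto
qed

lemma antisym_ext_scale:
  fixes u v :: "nat list \<Rightarrow> 'a::ring_1"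
  assumes J: "good_idx n m r J" and r: "1 \<le> r" and v: "\<And>I. I \<in> ess_idx n m r \<Longrightarrow> v I = c * u I"
  shows "antisym_ext v J = c * antisym_ext u J"
proof (cases "distinct J")
  case True
  obtain p :: "nat \<Rightarrow> nat" and K where "K \<in> ess_idx n m r"
    and "\<forall>u :: nat list \<Rightarrow> 'a. antisym_ext u J = of_int (sign p) * u K"
    using antisym_ext_good_idx[OF J r True, where 'a = 'a] by blast
  then show ?thesis by (simp add: v sign_def)
next
  case False
  then show ?thesis
    by (simp add: alternating_not_distinct[OF alternating_antisym_ext refl False])
qed

text \<open>Both sides are quadratic in the coordinates and acquire the factor \<open>c * c\<close>.
  So the relation passes from one representative of a projective class to the others.\<close>

lemma exchange_rel_scale:
  assumes c: "central c" and r: "1 \<le> r" and v: "\<And>I. I \<in> ess_idx n m r \<Longrightarrow> v I = c * u I"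
    and as: "length as = r" "set as \<subseteq> {..<n}" and bs: "good_idx n m r bs"
    and rel: "exchange_rel r (antisym_ext u) 0 as bs"
  shows "exchange_rel r (antisym_ext v) 0 as bs"
proof -
  note sc = antisym_ext_scale[OF _ r v]
  have a0: "as ! 0 < n" using as r by (simp add: set_subset_lessThan_iff)
  have good: "good_idx n m r (as[0 := bs ! j])" if "j < r" for j
    using good_idx_nth[OF bs that] as
    by (auto simp: good_idx_def set_subset_lessThan_iff nth_list_update)
  have c2: "c * x * (c * y) = c * c * (x * y)" for x y
    using central_left_commute[OF c] by (metis mult.assoc)
  have "antisym_ext v as * antisym_ext v bs = c * c * (antisym_ext u as * antisym_ext u bs)"
    by (simp add: sc[OF good_idx_even[OF as]] sc[OF bs] c2)
  also have "\<dots> = (\<Sum>j<r. antisym_ext v (as[0 := bs ! j]) * antisym_ext v (bs[j := as ! 0]))"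
    using rel unfolding exchange_rel_def
    by (simp add: sum_distrib_left sc[OF good] sc[OF good_idx_update[OF bs a0]] c2)
  finally show ?thesis by (simp add: exchange_rel_def)
qed

text \<open>If the odd entry of \<open>bs\<close> stands last, the summand \<open>j = r - 1\<close>
  is the separate final term of the odd relation. Any other place of the odd entry is reduced to
  this one by permuting \<open>bs\<close>.\<close>

lemma exchange_rel_iff_plucker_relations:
  assumes f: "alternating r f" and r: "1 \<le> r"
  shows "(\<forall>as bs. length as = r \<and> set as \<subseteq> {..<n} \<and> good_idx n m r bs \<longrightarrow> exchange_rel r f 0 as bs) \<longleftrightarrow>
    (\<forall>as bs. length as = r \<and> set as \<subseteq> {..<n} \<and> length bs = r \<and> set bs \<subseteq> {..<n} \<longrightarrow>
        f as * f bs = (\<Sum>j<r. f (as[0 := bs ! j]) * f (bs[j := as ! 0]))) \<and>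
    (\<forall>as bs \<mu>. length as = r \<and> set as \<subseteq> {..<n} \<and> length bs = r - 1 \<and> set bs \<subseteq> {..<n} \<and> \<mu> < m \<longrightarrow>
        f as * f (bs @ [n + \<mu>]) =
          (\<Sum>j<r - 1. f (as[0 := bs ! j]) * f (bs[j := as ! 0] @ [n + \<mu>]))
          + f (as[0 := n + \<mu>]) * f (bs @ [as ! 0]))"
    (is "?L \<longleftrightarrow> ?E \<and> ?O")
proof -
  have odd_iff: "exchange_rel r f 0 as (bs @ [x]) \<longleftrightarrow> f as * f (bs @ [x]) =
      (\<Sum>j<r - 1. f (as[0 := bs ! j]) * f (bs[j := as ! 0] @ [x])) + f (as[0 := x]) * f (bs @ [as ! 0])"
    if "length bs = r - 1" for as bs x
  proof -
    obtain s where s: "r = Suc s" using r by (cases r) auto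
    then have len: "length bs = s" using that by simp
    have "(\<Sum>j<s. f (as[0 := (bs @ [x]) ! j]) * f ((bs @ [x])[j := as ! 0])) =
        (\<Sum>j<s. f (as[0 := bs ! j]) * f (bs[j := as ! 0] @ [x]))"
      by (rule sum.cong) (use len in \<open>auto simp: nth_append list_update_append\<close>)
    then show ?thesis
      using len by (simp add: exchange_rel_def s list_update_append nth_append)
  qed
  show ?thesis
  proof
    assume L: ?L
    have ?E
      using L by (auto simp: exchange_rel_def[symmetric] good_idx_even)
    moreover have ?O
    proof (intro allI impI)
      fix as bs \<mu>
      assume *: "length as = r \<and> set as \<subseteq> {..<n} \<and> length bs = r - 1 \<and> set bs \<subseteq> {..<n} \<and> \<mu> < m"
      then have "exchange_rel r f 0 as (bs @ [n + \<mu>])"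
        using L good_idx_append[of bs r n "n + \<mu>" m] r by simp
      then show "f as * f (bs @ [n + \<mu>]) =
          (\<Sum>j<r - 1. f (as[0 := bs ! j]) * f (bs[j := as ! 0] @ [n + \<mu>]))
          + f (as[0 := n + \<mu>]) * f (bs @ [as ! 0])"
        using odd_iff * by blast
    qed
    ultimately show "?E \<and> ?O" by blast
  next
    assume EO: "?E \<and> ?O"
    show ?L
    proof (intro allI impI, elim conjE)
      fix as bs assume as: "length as = r" "set as \<subseteq> {..<n}" and bs: "good_idx n m r bs"
      have len: "length bs = r" using bs by (rule good_idx_length)
      show "exchange_rel r f 0 as bs"
      proof (cases "set bs \<subseteq> {..<n}")
        case True
        then show ?thesis using EO as len by (auto simp: exchange_rel_def)
      next
        case False
        then obtain k where k: "k < r" "n \<le> bs ! k"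
          using len by (auto simp: set_subset_lessThan_iff not_less)
        \<comment> \<open>This moves the odd entry from position \<open>k\<close> to the
          end.\<close>
        let ?q = "Transposition.transpose k (r - 1)"
        have q: "?q permutes {..<r}" using k by (intro permutes_swap_id) auto
        have "n \<le> permute_list ?q bs ! (r - 1)"
          using q k len by (simp add: permute_list_nth)
        then obtain cs \<mu> where cs: "permute_list ?q bs = cs @ [n + \<mu>]" "\<mu> < m"
            "length cs = r - 1" "set cs \<subseteq> {..<n}"
          using good_idx_snoc[OF good_idx_permute[OF bs q] r] by metis
        then have "exchange_rel r f 0 as (permute_list ?q bs)"
          using EO as odd_iff[OF cs(3)] by simp
        then show ?thesis by (rule exchange_rel_permute_right[OF f as(1) len q])
      qed
    qed
  qed
qed

lemma col_submat_lift_cols: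
  assumes M: "M \<in> carrier_mat r N" and J: "set J \<subseteq> {..<N}"
  shows "col_submat (lift_cols S M) J = lift_cols {j. J ! j \<in> S} (col_submat M J)"
proof -
  have "J ! j < N" if "j < length J" for j using J that nth_mem by blast
  then show ?thesis
    using M by (auto intro!: eq_matI simp: col_submat_def lift_cols_def)
qed

section \<open>The super Pluecker map\<close>

lemma invertible_elem_mult:
  assumes "invertible_elem a" "invertible_elem b"
  shows "invertible_elem (a * b)"
proof -
  obtain a' b' where *: "a * a' = 1" "a' * a = 1" "b * b' = 1" "b' * b = 1"
    using assms by (auto simp: invertible_elem_def)
  have "a * b * (b' * a') = a * (b * b') * a'" "b' * a' * (a * b) = b' * (a' * a) * b"
    by (simp_all only: mult.assoc)
  then show ?thesis using * unfolding invertible_elem_def by (intro exI[of _ "b' * a'"]) simp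
qed

context comm_superalgebra
begin

lemma central_even: "x \<in> A0 \<Longrightarrow> central x"
  unfolding central_def
proof
  fix y assume x: "x \<in> A0"
  obtain a b where "a \<in> A0" "b \<in> A1" "y = a + b" using even_plus_odd by blast
  then show "x * y = y * x"
    using x by (simp add: algebra_simps commute_even_even commute_even_odd)
qed

lemmas even_zero = subspace_0[OF subspace_even]
  and even_neg = subspace_neg[OF subspace_even]
  and even_diff = subspace_diff[OF subspace_even]
  and even_sum = subspace_sum[OF subspace_even]
  and odd_zero = subspace_0[OF subspace_odd]
  and odd_neg = subspace_neg[OF subspace_odd]
  and odd_sum = subspace_sum[OF subspace_odd]

lemma even_sign_mult: "x \<in> A0 \<Longrightarrow> of_int (sign p) * x \<in> A0"
  by (simp add: sign_def even_neg)

lemma odd_sign_mult: "x \<in> A1 \<Longrightarrow> of_int (sign p) * x \<in> A1"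
  by (simp add: sign_def odd_neg)

text \<open>For the odd part \<open>b\<close> of \<open>d\<close>, the element
  \<open>c * b = 1 - c * a\<close> is both odd and even, hence 0; multiplying by \<open>d\<close>
  gives \<open>b = 0\<close>.\<close>

lemma even_inverse:
  assumes c: "c \<in> A0" and d: "c * d = 1"
  shows "d \<in> A0"
proof -
  obtain a b where ab: "a \<in> A0" "b \<in> A1" "d = a + b" using even_plus_odd by blast
  have "c * b = 1 - c * a" using d ab by (simp add: algebra_simps)
  moreover have "1 - c * a \<in> A0" using c ab by (intro even_diff one_even even_even)
  moreover have "c * b \<in> A1" using c ab by (intro even_odd)
  ultimately have "c * b \<in> A0 \<inter> A1" by simp
  then have "c * b = 0" using even_Int_odd by simp
  then have "d * (c * b) = 0" by simp
  moreover have "d * c = 1" using d central_even[OF c] by (simp add: central_def)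
  ultimately have "b = 0" by (simp flip: mult.assoc)
  then show ?thesis using ab by simp
qed

lemma prod_list_even: "(\<And>x. x \<in> set xs \<Longrightarrow> x \<in> A0) \<Longrightarrow> prod_list xs \<in> A0"
  by (induction xs) (auto intro: one_even even_even)

lemma prod_list_odd:
  assumes "k < length xs" "xs ! k \<in> A1" "\<And>i. i < length xs \<Longrightarrow> i \<noteq> k \<Longrightarrow> xs ! i \<in> A0"
  shows "prod_list xs \<in> A1"
  using assms
proof (induction xs arbitrary: k)
  case (Cons x xs)
  show ?case
  proof (cases k)
    case 0
    have "y \<in> A0" if "y \<in> set xs" for y
    proof -
      obtain i where "i < length xs" "y = xs ! i"
        using \<open>y \<in> set xs\<close> by (auto simp: in_set_conv_nth)
      then show ?thesis using Cons.prems(3)[of "Suc i"] 0 by simp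
    qed
    then have "prod_list xs \<in> A0" by (rule prod_list_even)
    then show ?thesis using Cons.prems 0 by (auto intro: odd_even)
  next
    case (Suc l)
    have "xs ! i \<in> A0" if "i < length xs" "i \<noteq> l" for i
      using Cons.prems(3)[of "Suc i"] that Suc by simp
    then have "prod_list xs \<in> A1" using Cons.IH[of l] Cons.prems Suc by simp
    moreover have "x \<in> A0" using Cons.prems(3)[of 0] Suc by simp
    ultimately show ?thesis by (auto intro: even_odd)
  qed
qed simp

lemma sdet_even:
  assumes M: "M \<in> carrier_mat r r" "\<And>i j. i < r \<Longrightarrow> j < r \<Longrightarrow> M $$ (i, j) \<in> A0"
  shows "sdet M \<in> A0"
  unfolding sdet_def
proof (rule even_sum, clarify, rule even_sign_mult, rule prod_list_even)
  fix p x assume p: "p permutes {..<dim_row M}"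
    and "x \<in> set (map (\<lambda>i. M $$ (i, p i)) [0..<dim_row M])"
  then obtain i where "i < r" "x = M $$ (i, p i)" using M by auto
  then show "x \<in> A0" using M permutes_in_image[OF p, of i] by auto
qed

lemma sdet_odd:
  assumes M: "M \<in> carrier_mat r r" and k: "k < r"
    and odd: "\<And>i. i < r \<Longrightarrow> M $$ (i, k) \<in> A1"
    and even: "\<And>i j. i < r \<Longrightarrow> j < r \<Longrightarrow> j \<noteq> k \<Longrightarrow> M $$ (i, j) \<in> A0"
  shows "sdet M \<in> A1"
  unfolding sdet_def
proof (rule odd_sum, clarify, rule odd_sign_mult)
  fix p assume p: "p permutes {..<dim_row M}"
  have r: "dim_row M = r" using M by simp
  let ?xs = "map (\<lambda>i. M $$ (i, p i)) [0..<dim_row M]"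
  \<comment> \<open>The row that \<open>p\<close> sends to the odd column \<open>k\<close>; it
    contributes the one odd factor of the product.\<close>
  define l where "l = Hilbert_Choice.inv p k"
  have pl: "p l = k" using permutes_inverses(1)[OF p] by (simp add: l_def)
  have l: "l < r" using permutes_in_image[OF p, of l] pl k r by simp
  show "prod_list ?xs \<in> A1"
  proof (rule prod_list_odd[of l])
    fix i assume i: "i < length ?xs" "i \<noteq> l"
    then have "p i \<noteq> k" using pl permutes_inj[OF p] by (auto dest: injD)
    then show "?xs ! i \<in> A0" using i r permutes_in_image[OF p, of i] by (auto intro: even)
  qed (use l pl r odd in auto)
qed

lemma antisym_ext_parity:
  assumes u: "u \<in> ess_coords A0 A1 n m r" and J: "good_idx n m r J" and r: "1 \<le> r"
  shows "if set J \<subseteq> {..<n} then antisym_ext u J \<in> A0 else antisym_ext u J \<in> A1"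
proof (cases "distinct J")
  case True
  obtain p :: "nat \<Rightarrow> nat" and K
    where "if set J \<subseteq> {..<n} then K \<in> even_idx n r else K \<in> odd_idx n m r"
      and "\<forall>u :: nat list \<Rightarrow> 'a. antisym_ext u J = of_int (sign p) * u K"
    using antisym_ext_good_idx[OF J r True, where 'a = 'a] by blast
  then show ?thesis
    using u by (auto simp: ess_coords_def even_sign_mult odd_sign_mult)
next
  case False
  then show ?thesis
    by (simp add: alternating_not_distinct[OF alternating_antisym_ext refl False] even_zero odd_zero)
qed

lemma gr_mats_carrier: "U \<in> gr_mats A0 A1 n m r \<Longrightarrow> U \<in> carrier_mat r (n + m)"
  by (simp add: gr_mats_def)

lemma gr_mats_even: "U \<in> gr_mats A0 A1 n m r \<Longrightarrow> i < r \<Longrightarrow> a < n \<Longrightarrow> U $$ (i, a) \<in> A0"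
  by (simp add: gr_mats_def)

lemma gr_mats_odd:
  assumes "U \<in> gr_mats A0 A1 n m r" "i < r" "n \<le> a" "a < n + m"
  shows "U $$ (i, a) \<in> A1"
proof -
  have "\<forall>\<mu><m. U $$ (i, n + \<mu>) \<in> A1" using assms by (simp add: gr_mats_def)
  from this[rule_format, of "a - n"] show ?thesis using assms by simp
qed

text \<open>All coordinates of \<open>U\<close>, even and odd, thus come from minors of a single
  matrix over a commutative ring.\<close>

lemma sdet_col_submat_eq_collapse:
  assumes U: "U \<in> gr_mats A0 A1 n m r" and J: "good_idx n m r J"
  shows "sdet (col_submat U J) = collapse (det (col_submat (lift_cols {..<n} U) J))"
proof -
  have len: "length J = r" and sub: "set J \<subseteq> {..<n + m}" using J by (auto simp: good_idx_def)
  note c = gr_mats_carrier[OF U]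
  have "sdet (col_submat U J) = collapse (det (lift_cols {j. J ! j \<in> {..<n}} (col_submat U J)))"
  proof (rule sdet_eq_collapse_det)
    show "col_submat U J \<in> carrier_mat r r" using c len by simp
    show "central (col_submat U J $$ (i, j))" if "i < r" "j < r" "j \<in> {j. J ! j \<in> {..<n}}" for i j
      using that c len gr_mats_even[OF U] by (auto intro: central_even)
    show "j \<in> {j. J ! j \<in> {..<n}} \<or> k \<in> {j. J ! j \<in> {..<n}}" if "j < r" "k < r" "j \<noteq> k" for j k
      using J that by (auto simp: good_idx_def)
  qed
  then show ?thesis using col_submat_lift_cols[OF c sub] by simp
qed

lemma odd_part_det_lift_cols:
  assumes U: "U \<in> gr_mats A0 A1 n m r" and J: "length J = r" "set J \<subseteq> {..<n}"
  shows "odd_part (det (col_submat (lift_cols {..<n} U) J)) = 0"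
  by (rule odd_part_det[of _ r])
     (use gr_mats_carrier[OF U] J in \<open>auto simp: lift_cols_def col_submat_def set_subset_lessThan_iff
       intro: trans_less_add1\<close>)

lemma sdet_parity:
  assumes U: "U \<in> gr_mats A0 A1 n m r" and J: "good_idx n m r J"
  shows "if set J \<subseteq> {..<n} then sdet (col_submat U J) \<in> A0 else sdet (col_submat U J) \<in> A1"
proof (cases "set J \<subseteq> {..<n}")
  case True
  have "sdet (col_submat U J) \<in> A0"
    by (rule sdet_even[of _ r])
       (use True gr_mats_carrier[OF U] gr_mats_even[OF U] good_idx_length[OF J]
         in \<open>auto simp: set_subset_lessThan_iff\<close>)
  then show ?thesis using True by simp
next
  case False
  have len: "length J = r" using J by (rule good_idx_length)
  obtain k where k: "k < r" "n \<le> J ! k"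
    using False len by (auto simp: set_subset_lessThan_iff not_less)
  have even: "J ! j < n" if "j < r" "j \<noteq> k" for j
    using J that k by (fastforce simp: good_idx_def)
  have "sdet (col_submat U J) \<in> A1"
    by (rule sdet_odd[of _ r k])
       (use k len gr_mats_carrier[OF U] gr_mats_even[OF U] gr_mats_odd[OF U] even good_idx_nth[OF J]
         in auto)
  then show ?thesis using False by simp
qed

text \<open>Both sides alternate, the right one as the collapse of a commutative minor, and they
  agree on increasing indices. This covers odd columns in any position.\<close>

lemma antisym_ext_plucker_coords:
  assumes U: "U \<in> gr_mats A0 A1 n m r" and J: "good_idx n m r J" and r: "1 \<le> r"
  shows "antisym_ext (plucker_coords n m r U) J = sdet (col_submat U J)"
proof -
  let ?D = "\<lambda>J. det (col_submat (lift_cols {..<n} U) J)"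
  have D: "alternating r ?D"
    by (rule alternating_det[OF lift_cols_carrier[OF gr_mats_carrier[OF U]]])
  have len: "length J = r" using J by (rule good_idx_length)
  show ?thesis
  proof (cases "distinct J")
    case True
    obtain p :: "nat \<Rightarrow> nat" and K where p: "p permutes {..<r}" "K = permute_list p J"
      and K: "K \<in> ess_idx n m r"
      and eq: "\<forall>u :: nat list \<Rightarrow> 'a. antisym_ext u J = of_int (sign p) * u K"
      using antisym_ext_good_idx[OF J r True, where 'a = 'a] by blast
    have "sdet (col_submat U K) = of_int (sign p) * sdet (col_submat U J)"
      unfolding sdet_col_submat_eq_collapse[OF U J]
        sdet_col_submat_eq_collapse[OF U good_idx_ess[OF r K]]
      using alternating_permute[OF D len p(1)] p(2) by (simp add: collapse_sign_mult)
    then show ?thesis using eq K by (simp add: plucker_coords_def sign_mult_cancel)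
  next
    case False
    then show ?thesis
      using alternating_not_distinct[OF D len False] len
      by (simp add: alternating_not_distinct[OF alternating_antisym_ext refl False]
        sdet_col_submat_eq_collapse[OF U J])
  qed
qed

lemma plucker_coords_ess:
  assumes U: "U \<in> gr_mats A0 A1 n m r" and r: "1 \<le> r"
  shows "plucker_coords n m r U \<in> ess_coords A0 A1 n m r"
proof -
  have "sdet (col_submat U I) \<in> A0" if "I \<in> even_idx n r" for I
    using sdet_parity[OF U good_idx_even[of I r n m]] that by (simp add: even_idx_def)
  moreover have "sdet (col_submat U I) \<in> A1" if I: "I \<in> odd_idx n m r" for I
  proof -
    have "good_idx n m r I" using I r by (intro good_idx_ess) (auto simp: ess_idx_def)
    moreover have "\<not> set I \<subseteq> {..<n}" using I by (auto simp: odd_idx_def)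
    ultimately show ?thesis using sdet_parity[OF U] by simp
  qed
  moreover have "\<exists>I\<in>even_idx n r. invertible_elem (sdet (col_submat U I))"
  proof -
    obtain I where I: "I \<in> even_idx n r" "invertible_mat (col_submat U I)"
      using U by (auto simp: gr_mats_def)
    then have len: "length I = r" "set I \<subseteq> {..<n}" by (auto simp: even_idx_def)
    have "invertible_elem (sdet (col_submat U I))"
      by (rule invertible_sdet[of _ r, OF _ _ I(2)])
         (use len gr_mats_carrier[OF U] gr_mats_even[OF U] in
           \<open>auto simp: set_subset_lessThan_iff intro: central_even\<close>)
    then show ?thesis using I by blast
  qed
  ultimately show ?thesis
    unfolding ess_coords_def plucker_coords_def by (auto simp: ess_idx_def)
qed

text \<open>The classical relation holds for the lifted matrix; collapsing it is legitimate because
  in every product at least one minor has no odd column.\<close>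

lemma exchange_rel_plucker_coords:
  assumes U: "U \<in> gr_mats A0 A1 n m r" and r: "1 \<le> r"
    and as: "length as = r" "set as \<subseteq> {..<n}" and bs: "good_idx n m r bs"
  shows "exchange_rel r (antisym_ext (plucker_coords n m r U)) 0 as bs"
proof -
  let ?M = "lift_cols {..<n} U"
  let ?D = "\<lambda>J. det (col_submat ?M J)" and ?S = "\<lambda>J. sdet (col_submat U J)"
  have len: "length bs = r" using bs by (rule good_idx_length)
  have a0: "as ! 0 < n" using as r by (simp add: set_subset_lessThan_iff)
  note good_as = good_idx_even[OF as, of m]
  note S = sdet_col_submat_eq_collapse[OF U]
  have good: "good_idx n m r (as[0 := bs ! j])" if "j < r" for j
    using good_idx_nth[OF bs that] as
    by (auto simp: good_idx_def set_subset_lessThan_iff nth_list_update)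
  have summand: "collapse (?D (as[0 := bs ! j]) * ?D (bs[j := as ! 0])) = ?S (as[0 := bs ! j]) * ?S (bs[j := as ! 0])"
    if j: "j < r" for j
  proof -
    \<comment> \<open>The odd entry of \<open>bs\<close>, if there is one, either stays in
      \<open>bs\<close> or moves into \<open>as\<close>; the other index is then purely
      even.\<close>
    have "set (as[0 := bs ! j]) \<subseteq> {..<n} \<or> set (bs[j := as ! 0]) \<subseteq> {..<n}"
    proof (cases "bs ! j < n")
      case True
      then show ?thesis using as by (auto simp: set_subset_lessThan_iff nth_list_update)
    next
      case False
      then have "bs ! i < n" if "i < r" "i \<noteq> j" for i
        using bs that j by (fastforce simp: good_idx_def)
      then have "set (bs[j := as ! 0]) \<subseteq> {..<n}"
        using a0 len j by (auto simp: set_subset_lessThan_iff nth_list_update)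
      then show ?thesis ..
    qed
    then have "odd_part (?D (as[0 := bs ! j])) = 0 \<or> odd_part (?D (bs[j := as ! 0])) = 0"
      using odd_part_det_lift_cols[OF U] as len by auto
    then show ?thesis
      unfolding S[OF good[OF j]] S[OF good_idx_update[OF bs a0]] by (rule collapse_mult)
  qed
  have "collapse (?D as * ?D bs) = ?S as * ?S bs"
    unfolding S[OF good_as] S[OF bs]
    by (rule collapse_mult) (simp add: odd_part_det_lift_cols[OF U as])
  moreover have "?D as * ?D bs = (\<Sum>j<r. ?D (as[0 := bs ! j]) * ?D (bs[j := as ! 0]))"
    using exchange_rel_det[OF lift_cols_carrier[OF gr_mats_carrier[OF U]] as(1) len, of 0] r
    by (simp add: exchange_rel_def)
  ultimately have "?S as * ?S bs = (\<Sum>j<r. ?S (as[0 := bs ! j]) * ?S (bs[j := as ! 0]))"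
    by (simp add: collapse_sum summand)
  then show ?thesis
    unfolding exchange_rel_def
    by (simp add: antisym_ext_plucker_coords[OF U _ r] good_as bs good good_idx_update[OF bs a0])
qed

section \<open>From the relations back to a matrix\<close>

definition graded_lift :: "nat \<Rightarrow> nat list \<Rightarrow> 'a \<Rightarrow> 'a central_ext" where
  "graded_lift n J x = (if set J \<subseteq> {..<n} then of_even x else of_odd x)"

lemma collapse_graded_lift:
  "(set J \<subseteq> {..<n} \<Longrightarrow> central x) \<Longrightarrow> collapse (graded_lift n J x) = x"
  by (simp add: graded_lift_def)

lemma graded_lift_sign_mult:
  "(set J \<subseteq> {..<n} \<Longrightarrow> central x) \<Longrightarrow>
    graded_lift n J (of_int (sign p) * x) = of_int (sign p) * graded_lift n J x"
  by (simp add: graded_lift_def sign_def)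

lemma alternating_graded_lift:
  assumes f: "alternating r f" and cen: "\<And>J. length J = r \<Longrightarrow> set J \<subseteq> {..<n} \<Longrightarrow> central (f J)"
  shows "alternating r (\<lambda>J. graded_lift n J (f J))"
  unfolding alternating_def
proof (intro conjI allI impI)
  fix J :: "nat list" and p
  assume J: "length J = r" and p: "p permutes {..<r}"
  have "graded_lift n (permute_list p J) (f (permute_list p J)) = graded_lift n J (of_int (sign p) * f J)"
    using J p alternating_permute[OF f J p] by (simp add: graded_lift_def)
  then show "graded_lift n (permute_list p J) (f (permute_list p J)) = of_int (sign p) * graded_lift n J (f J)"
    using cen[OF J] by (simp add: graded_lift_sign_mult)
next
  fix J :: "nat list"
  assume "length J = r" "\<not> distinct J"
  then show "graded_lift n J (f J) = 0"
    using alternating_not_distinct[OF f] by (simp add: graded_lift_def)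
qed

text \<open>\<open>L\<close> is any index with the parity of the product; the case of two odd
  factors, whose product is 0 in the extension, is excluded.\<close>

lemma graded_lift_mult:
  assumes "set J \<subseteq> {..<n} \<Longrightarrow> central x" "set K \<subseteq> {..<n} \<Longrightarrow> central y"
    and "set J \<subseteq> {..<n} \<or> set K \<subseteq> {..<n}"
    and "set L \<subseteq> {..<n} \<longleftrightarrow> set J \<subseteq> {..<n} \<and> set K \<subseteq> {..<n}"
  shows "graded_lift n J x * graded_lift n K y = graded_lift n L (x * y)"
  using assms of_even_mult_of_odd[of y x] central_commute[of y x]
  by (cases "set J \<subseteq> {..<n}"; cases "set K \<subseteq> {..<n}")
     (simp_all add: graded_lift_def of_even_mult of_even_mult_of_odd mult.commute[of "of_odd x"])

text \<open>As \<open>as\<close> is even, every product in the relation has the parity of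
  \<open>bs\<close>, so the whole identity can be lifted at the index \<open>bs\<close>.\<close>

lemma exchange_rel_graded_lift:
  assumes cen: "\<And>J. length J = r \<Longrightarrow> set J \<subseteq> {..<n} \<Longrightarrow> central (f J)"
    and r: "1 \<le> r" and as: "length as = r" "set as \<subseteq> {..<n}" and bs: "good_idx n m r bs"
    and rel: "exchange_rel r f 0 as bs"
  shows "exchange_rel r (\<lambda>J. graded_lift n J (f J)) 0 as bs"
proof -
  have len: "length bs = r" using bs by (rule good_idx_length)
  have a0: "as ! 0 < n" using as r by (simp add: set_subset_lessThan_iff)
  have summand: "graded_lift n (as[0 := bs ! j]) (f (as[0 := bs ! j])) *
      graded_lift n (bs[j := as ! 0]) (f (bs[j := as ! 0])) =
      graded_lift n bs (f (as[0 := bs ! j]) * f (bs[j := as ! 0]))" if j: "j < r" for j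
  proof (rule graded_lift_mult)
    have A: "set (as[0 := bs ! j]) \<subseteq> {..<n} \<longleftrightarrow> bs ! j < n"
      using as(1) as(2)[unfolded set_subset_lessThan_iff] r by (auto simp: list_update_subset_lessThan_iff)
    have B: "set (bs[j := as ! 0]) \<subseteq> {..<n} \<longleftrightarrow> (\<forall>i<r. i \<noteq> j \<longrightarrow> bs ! i < n)"
      using a0 len j by (simp add: list_update_subset_lessThan_iff)
    show "set (as[0 := bs ! j]) \<subseteq> {..<n} \<or> set (bs[j := as ! 0]) \<subseteq> {..<n}"
      unfolding A B using bs j by (auto simp: good_idx_def)
    show "set bs \<subseteq> {..<n} \<longleftrightarrow> set (as[0 := bs ! j]) \<subseteq> {..<n} \<and> set (bs[j := as ! 0]) \<subseteq> {..<n}"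
      unfolding A B using j len by (auto simp: set_subset_lessThan_iff)
  qed (use as len in \<open>auto intro!: cen\<close>)
  \<comment> \<open>For even \<open>bs\<close> the sum is lifted by \<open>of_even\<close>, which is
    additive on central terms.\<close>
  have term_central: "central (f (as[0 := bs ! j]) * f (bs[j := as ! 0]))"
    if "j < r" "set bs \<subseteq> {..<n}" for j
    using that as len r a0
    by (intro central_mult cen) (auto simp: set_subset_lessThan_iff nth_list_update)
  have "graded_lift n as (f as) * graded_lift n bs (f bs) = graded_lift n bs (f as * f bs)"
    by (rule graded_lift_mult) (use as len in \<open>auto intro: cen\<close>)
  also have "\<dots> = (\<Sum>j<r. graded_lift n bs (f (as[0 := bs ! j]) * f (bs[j := as ! 0])))"
  proof (cases "set bs \<subseteq> {..<n}")
    case True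
    then have "of_even (\<Sum>j<r. f (as[0 := bs ! j]) * f (bs[j := as ! 0])) =
        (\<Sum>j<r. of_even (f (as[0 := bs ! j]) * f (bs[j := as ! 0])))"
      by (intro of_even_sum term_central) auto
    then show ?thesis using True rel by (simp add: exchange_rel_def graded_lift_def)
  next
    case False
    then show ?thesis using rel by (simp add: exchange_rel_def graded_lift_def of_odd_sum)
  qed
  finally show ?thesis by (simp add: exchange_rel_def summand)
qed

text \<open>This is the surjectivity half: the matrix is found in the affine chart where
  \<open>u I\<close> is invertible, and the scalar \<open>c\<close> is \<open>u I\<close>.\<close>

lemma ex_gr_mats_if_exchange_rel:
  assumes u: "u \<in> ess_coords A0 A1 n m r" and r: "1 \<le> r"
    and rel: "\<And>as bs. length as = r \<Longrightarrow> set as \<subseteq> {..<n} \<Longrightarrow> good_idx n m r bs \<Longrightarrow>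
      exchange_rel r (antisym_ext u) 0 as bs"
  shows "\<exists>U\<in>gr_mats A0 A1 n m r. \<exists>c\<in>A0. invertible_elem c \<and>
    (\<forall>J\<in>ess_idx n m r. u J = c * plucker_coords n m r U J)"
proof -
  obtain I d where I: "I \<in> even_idx n r" and d: "u I * d = 1" "d * u I = 1"
    using u by (auto simp: ess_coords_def invertible_elem_def)
  have len: "length I = r" and In: "set I \<subseteq> {..<n}" and sI: "sorted_wrt (<) I"
    using I by (auto simp: even_idx_def)
  have dI: "distinct I" using sI by (simp add: strict_sorted_iff)
  have uI: "u I \<in> A0" using u I by (simp add: ess_coords_def)
  have d0: "d \<in> A0" using even_inverse[OF uI d(1)] .
  let ?f = "antisym_ext u"
  have f: "alternating r ?f" by (rule alternating_antisym_ext)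
  have fI: "?f I = u I" by (rule antisym_ext_sorted[OF sI])
  \<comment> \<open>The representative with the identity in the columns \<open>I\<close>: its entry
    at \<open>(i, a)\<close> must be the minor for \<open>I[i := a]\<close>, that is, the coordinate
    there divided by \<open>u I\<close>.\<close>
  define U where "U = mat r (n + m) (\<lambda>(i, a). d * ?f (I[i := a]))"
  have U: "U \<in> carrier_mat r (n + m)" by (simp add: U_def)
  have goodI: "good_idx n m r (I[i := a])" if "a < n + m" for i a
    using that len In
    by (cases "i < r") (auto simp: good_idx_def set_subset_lessThan_iff nth_list_update)
  have evenI: "set (I[i := a]) \<subseteq> {..<n} \<longleftrightarrow> a < n" if "i < r" for i a
    using that len In[unfolded set_subset_lessThan_iff]
    by (auto simp: list_update_subset_lessThan_iff)
  have U1: "col_submat U I = 1\<^sub>m r"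
  proof (rule eq_matI)
    fix i j assume "i < dim_row (1\<^sub>m r :: 'a mat)" "j < dim_col (1\<^sub>m r :: 'a mat)"
    then have ij: "i < r" "j < r" by auto
    have "I ! j < n" using In ij len by (simp add: set_subset_lessThan_iff)
    moreover have "?f (I[i := I ! j]) = 0" if "i \<noteq> j"
    proof (rule alternating_not_distinct[OF f])
      show "\<not> distinct (I[i := I ! j])"
        using ij len that nth_eq_iff_index_eq[of "I[i := I ! j]" i j] by auto
    qed (simp add: len)
    ultimately show "col_submat U I $$ (i, j) = 1\<^sub>m r $$ (i, j)"
      using ij len d fI by (auto simp: U_def)
  qed (use U len in \<open>auto simp: col_submat_def\<close>)
  have Ugr: "U \<in> gr_mats A0 A1 n m r"
    unfolding gr_mats_def
  proof (intro CollectI conjI allI impI)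
    show "U $$ (i, a) \<in> A0" if "i < r" "a < n" for i a
      using that antisym_ext_parity[OF u goodI[of a i] r] evenI d0
      by (auto simp: U_def intro: even_even)
    show "U $$ (i, n + \<mu>) \<in> A1" if "i < r" "\<mu> < m" for i \<mu>
      using that antisym_ext_parity[OF u goodI[of "n + \<mu>" i] r] evenI[of i "n + \<mu>"] d0
      by (auto simp: U_def intro: even_odd)
    have "invertible_mat (1\<^sub>m r :: 'a mat)"
      by (auto simp: invertible_mat_def inverts_mat_def intro!: exI[of _ "1\<^sub>m r"])
    then show "\<exists>I\<in>even_idx n r. invertible_mat (col_submat U I)" using I U1 by metis
  qed (rule U)
  let ?F = "\<lambda>J. graded_lift n J (?f J)"
  let ?M = "lift_cols {..<n} U"
  have cen: "central (?f J)" if "length J = r" "set J \<subseteq> {..<n}" for J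
    using antisym_ext_parity[OF u good_idx_even[OF that] r] that by (simp add: central_even)
  have FI: "?F I = of_even (u I)" using In fI by (simp add: graded_lift_def)
  \<comment> \<open>Reconstruction is carried out for the lifted coordinates and the lifted matrix,
    where the ring is commutative.\<close>
  have F: "?F J = ?F I * det (col_submat ?M J)" if J: "good_idx n m r J" for J
  proof (rule exchange_rel_imp_det[where P = "good_idx n m r" and N = "n + m" and d = "of_even d"])
    show "alternating r ?F" by (rule alternating_graded_lift[OF f cen])
    show "?F I * of_even d = 1"
      using FI d by (simp add: central_even uI d0 flip: of_even_mult)
    show "exchange_rel r ?F 0 as bs"
      if "set as = set I" "length as = r" "good_idx n m r bs" for as bs
      using that In by (intro exchange_rel_graded_lift[OF cen r] rel) auto
    show "good_idx n m r (bs[j := a])" if "good_idx n m r bs" "a \<in> set I" for bs j a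
      using that In by (auto intro: good_idx_update)
    show "?M $$ (i, a) = of_even d * ?F (I[i := a])" if "i < r" "a < n + m" for i a
      using that evenI[of i a] cen[of "I[i := a]"] len
      by (auto simp: lift_cols_def U_def graded_lift_def of_even_mult of_even_mult_of_odd
          central_even d0)
  qed (use len dI r In U J in \<open>auto simp: good_idx_def\<close>)
  \<comment> \<open>Back in the algebra: \<open>?F I\<close> has no odd part, so the product
    collapses factorwise.\<close>
  have main: "?f J = u I * sdet (col_submat U J)" if J: "good_idx n m r J" for J
  proof -
    have "?f J = collapse (?F J)"
      using cen good_idx_length[OF J] by (simp add: collapse_graded_lift)
    also have "\<dots> = collapse (?F I) * collapse (det (col_submat ?M J))"
      unfolding F[OF J] by (rule collapse_mult) (simp add: FI)
    also have "\<dots> = u I * sdet (col_submat U J)"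
      by (simp add: FI central_even uI sdet_col_submat_eq_collapse[OF Ugr J])
    finally show ?thesis .
  qed
  have "u J = u I * plucker_coords n m r U J" if J: "J \<in> ess_idx n m r" for J
    using main[OF good_idx_ess[OF r J]] antisym_ext_sorted[OF ess_idx_sorted[OF J], of u] J
    by (simp add: plucker_coords_def)
  then show ?thesis
    using Ugr uI d unfolding invertible_elem_def by blast
qed

section \<open>Passage to classes and the image of the map\<close>

lemma equiv_ess_rel: "equiv (ess_coords A0 A1 n m r) (ess_rel A0 A1 n m r)"
proof (rule equivI)
  show "ess_rel A0 A1 n m r \<subseteq> ess_coords A0 A1 n m r \<times> ess_coords A0 A1 n m r"
    by (auto simp: ess_rel_def)
  show "refl_on (ess_coords A0 A1 n m r) (ess_rel A0 A1 n m r)"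
    by (auto simp: refl_on_def ess_rel_def invertible_elem_def intro!: bexI[of _ 1] one_even)
  show "sym (ess_rel A0 A1 n m r)"
  proof (rule symI)
    fix u v assume "(u, v) \<in> ess_rel A0 A1 n m r"
    then obtain c d where *: "u \<in> ess_coords A0 A1 n m r" "v \<in> ess_coords A0 A1 n m r"
      "c \<in> A0" "\<forall>I\<in>ess_idx n m r. v I = c * u I" and d: "c * d = 1" "d * c = 1"
      by (auto simp: ess_rel_def invertible_elem_def)
    \<comment> \<open>Symmetry requires the inverse of an even scalar to be even again.\<close>
    have "d \<in> A0" using even_inverse[OF *(3) d(1)] .
    moreover have "u I = d * v I" if "I \<in> ess_idx n m r" for I
      using * d that by (simp flip: mult.assoc)
    ultimately show "(v, u) \<in> ess_rel A0 A1 n m r"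
      using * d unfolding ess_rel_def invertible_elem_def by blast
  qed
  show "trans (ess_rel A0 A1 n m r)"
  proof (rule transI)
    fix u v w assume "(u, v) \<in> ess_rel A0 A1 n m r" "(v, w) \<in> ess_rel A0 A1 n m r"
    then obtain c d where *: "u \<in> ess_coords A0 A1 n m r" "w \<in> ess_coords A0 A1 n m r"
      "c \<in> A0" "invertible_elem c" "\<forall>I\<in>ess_idx n m r. v I = c * u I"
      "d \<in> A0" "invertible_elem d" "\<forall>I\<in>ess_idx n m r. w I = d * v I"
      by (auto simp: ess_rel_def)
    then have "d * c \<in> A0" "invertible_elem (d * c)" "\<forall>I\<in>ess_idx n m r. w I = d * c * u I"
      by (auto simp: even_even invertible_elem_mult mult.assoc)
    then show "(u, w) \<in> ess_rel A0 A1 n m r"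
      using * unfolding ess_rel_def by blast
  qed
qed

lemma gr_rel_refl:
  assumes U: "U \<in> gr_mats A0 A1 n m r"
  shows "(U, U) \<in> gr_rel A0 A1 n m r"
proof -
  have "1\<^sub>m r \<in> GL_even A0 r"
    by (auto simp: GL_even_def invertible_mat_def inverts_mat_def one_even even_zero
        intro!: exI[of _ "1\<^sub>m r"] dest!: elements_matD)
  moreover have "U = 1\<^sub>m r * U" using gr_mats_carrier[OF U] by simp
  ultimately show ?thesis using U unfolding gr_rel_def by blast
qed

text \<open>Left multiplication by \<open>g\<close> acts on every column submatrix alike, so all
  coordinates acquire the common even invertible factor \<open>sdet g\<close>.\<close>

lemma plucker_coords_gr_rel:
  assumes rel: "(U, W) \<in> gr_rel A0 A1 n m r" and r: "1 \<le> r"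
  shows "(plucker_coords n m r U, plucker_coords n m r W) \<in> ess_rel A0 A1 n m r"
proof -
  obtain g where U: "U \<in> gr_mats A0 A1 n m r" and W: "W \<in> gr_mats A0 A1 n m r"
    and g: "g \<in> GL_even A0 r" and eq: "W = g * U"
    using rel by (auto simp: gr_rel_def)
  have g0: "g $$ (i, j) \<in> A0" if "i < r" "j < r" for i j
    using g that by (auto simp: GL_even_def)
  have gc: "g \<in> carrier_mat r r" and ginv: "invertible_mat g" using g by (auto simp: GL_even_def)
  note Uc = gr_mats_carrier[OF U]
  have "sdet (col_submat W J) = sdet g * sdet (col_submat U J)" if "J \<in> ess_idx n m r" for J
  proof -
    have J: "good_idx n m r J" using good_idx_ess[OF r that] .
    have len: "length J = r" using J by (rule good_idx_length)
    have "col_submat W J = g * col_submat U J"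
      using gc Uc len good_idx_nth[OF J]
      by (auto intro!: eq_matI sum.cong simp: eq col_submat_def scalar_prod_def)
    moreover have "sdet (g * col_submat U J) = sdet g * sdet (col_submat U J)"
    proof (rule sdet_mult[OF gc])
      show "central (g $$ (i, j))" if "i < r" "j < r" for i j
        using g0[OF that] by (rule central_even)
      show "central (col_submat U J $$ (i, j))" if "i < r" "j < r" "j \<in> {j. J ! j < n}" for i j
        using that len Uc gr_mats_even[OF U] by (auto intro: central_even)
      show "j \<in> {j. J ! j < n} \<or> k \<in> {j. J ! j < n}" if "j < r" "k < r" "j \<noteq> k" for j k
        using J that by (auto simp: good_idx_def)
    qed (use Uc len in simp)
    ultimately show ?thesis by simp
  qed
  moreover have "sdet g \<in> A0" by (rule sdet_even[OF gc g0])
  moreover have "invertible_elem (sdet g)"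
    by (rule invertible_sdet[OF gc _ ginv]) (intro central_even g0)
  ultimately show ?thesis
    using plucker_coords_ess[OF U r] plucker_coords_ess[OF W r]
    by (auto simp: ess_rel_def plucker_coords_def)
qed

text \<open>The union in \<open>plucker\<close> runs over equal classes, so any single
  representative \<open>U\<close> computes the map.\<close>

lemma plucker_class:
  assumes U: "U \<in> gr_mats A0 A1 n m r" and r: "1 \<le> r"
  shows "plucker A0 A1 n m r (gr_rel A0 A1 n m r `` {U}) = ess_rel A0 A1 n m r `` {plucker_coords n m r U}"
proof -
  have "ess_rel A0 A1 n m r `` {plucker_coords n m r W} = ess_rel A0 A1 n m r `` {plucker_coords n m r U}"
    if "W \<in> gr_rel A0 A1 n m r `` {U}" for W
    using equiv_class_eq[OF equiv_ess_rel plucker_coords_gr_rel[OF _ r]] that by auto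
  then show ?thesis using gr_rel_refl[OF U] unfolding plucker_def by blast
qed

lemma plucker_image:
  assumes r: "1 \<le> r"
  shows "plucker A0 A1 n m r ` Gr A0 A1 n m r =
    {X \<in> P_ess A0 A1 n m r. \<forall>u\<in>X. \<forall>as bs. length as = r \<and> set as \<subseteq> {..<n} \<and> good_idx n m r bs \<longrightarrow>
      exchange_rel r (antisym_ext u) 0 as bs}"
    (is "_ = {X \<in> _. \<forall>u\<in>X. ?rel u}")
proof (intro equalityI subsetI)
  fix X assume "X \<in> plucker A0 A1 n m r ` Gr A0 A1 n m r"
  then obtain U where U: "U \<in> gr_mats A0 A1 n m r"
    and X: "X = ess_rel A0 A1 n m r `` {plucker_coords n m r U}"
    using plucker_class[OF _ r] by (auto simp: Gr_def quotient_def)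
  \<comment> \<open>Each representative is an even multiple of the coordinates of \<open>U\<close>,
    so the relations proved for minors carry over by scaling.\<close>
  have "?rel v" if "v \<in> X" for v
  proof -
    obtain c where c: "c \<in> A0" "\<And>I. I \<in> ess_idx n m r \<Longrightarrow> v I = c * plucker_coords n m r U I"
      using \<open>v \<in> X\<close> X by (auto simp: ess_rel_def)
    show ?thesis
    proof (intro allI impI)
      fix as bs
      assume *: "length as = r \<and> set as \<subseteq> {..<n} \<and> good_idx n m r bs"
      then show "exchange_rel r (antisym_ext v) 0 as bs"
        using exchange_rel_plucker_coords[OF U r, of as bs]
        by (intro exchange_rel_scale[OF central_even[OF c(1)] r, of n m v "plucker_coords n m r U"] c(2))
          auto
    qed
  qed
  then show "X \<in> {X \<in> P_ess A0 A1 n m r. \<forall>u\<in>X. ?rel u}"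
    using X plucker_coords_ess[OF U r] by (auto simp: P_ess_def quotientI)
next
  fix X assume "X \<in> {X \<in> P_ess A0 A1 n m r. \<forall>u\<in>X. ?rel u}"
  then obtain u where u: "u \<in> ess_coords A0 A1 n m r" and X: "X = ess_rel A0 A1 n m r `` {u}"
    and rel: "\<forall>u\<in>X. ?rel u"
    by (auto simp: P_ess_def quotient_def)
  have "u \<in> X" using X equiv_class_self[OF equiv_ess_rel u] by simp
  then obtain U c where U: "U \<in> gr_mats A0 A1 n m r" and c: "c \<in> A0" "invertible_elem c"
    "\<forall>J\<in>ess_idx n m r. u J = c * plucker_coords n m r U J"
    using ex_gr_mats_if_exchange_rel[OF u r] rel by blast
  then have "(plucker_coords n m r U, u) \<in> ess_rel A0 A1 n m r"
    using u plucker_coords_ess[OF U r] by (auto simp: ess_rel_def)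
  then have "X = plucker A0 A1 n m r (gr_rel A0 A1 n m r `` {U})"
    using X plucker_class[OF U r] equiv_class_eq[OF equiv_ess_rel] by metis
  then show "X \<in> plucker A0 A1 n m r ` Gr A0 A1 n m r"
    using U by (auto simp: Gr_def quotientI)
qed

end

theorem theorem7:
  fixes scale :: "'k::field \<Rightarrow> 'a::ring_1 \<Rightarrow> 'a"
    and A0 A1 :: "'a set"
    and n m r :: nat
  assumes "comm_superalgebra scale A0 A1"
    and "1 \<le> r" and "r \<le> n"
  shows "plucker A0 A1 n m r ` Gr A0 A1 n m r =
    {X \<in> P_ess A0 A1 n m r. \<forall>u\<in>X.
      (\<forall>as bs. length as = r \<and> set as \<subseteq> {..<n} \<and> length bs = r \<and> set bs \<subseteq> {..<n} \<longrightarrow>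
        antisym_ext u as * antisym_ext u bs =
          (\<Sum>j<r. antisym_ext u (as[0 := bs ! j]) * antisym_ext u (bs[j := as ! 0]))) \<and>
      (\<forall>as bs \<mu>. length as = r \<and> set as \<subseteq> {..<n} \<and> length bs = r - 1 \<and> set bs \<subseteq> {..<n} \<and> \<mu> < m \<longrightarrow>
        antisym_ext u as * antisym_ext u (bs @ [n + \<mu>]) =
          (\<Sum>j<r - 1. antisym_ext u (as[0 := bs ! j]) * antisym_ext u (bs[j := as ! 0] @ [n + \<mu>]))
          + antisym_ext u (as[0 := n + \<mu>]) * antisym_ext u (bs @ [as ! 0]))}"
  \<comment> \<open>For each representative \<open>u\<close>, the alternating function
    \<open>antisym_ext u\<close> translates the uniform exchange relation into the even and odd
    families.\<close>
  using comm_superalgebra.plucker_image[OF assms(1,2), of n m]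
  unfolding exchange_rel_iff_plucker_relations[OF alternating_antisym_ext assms(2)] .

end
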